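(* Let $f(\tau)=\sum_{n\ge 0}c_f(n)q^n\in\mathcal{E}$ be a quasimodular Eisenstein series. Let $r\in\mathbb{N}=\{1,2,3,\dots\}$ be such that for every $\varepsilon>0$ there exists $C_\varepsilon>0$ satisfying $$|c_f(n)|\le C_\varepsilon\, n^{r-1+\varepsilon}\qquad\text{for every } n\in\mathbb{N}.$$ Then $f\in\widetilde{\Omega}$ (that is, $c_f(p)=0$ for every prime $p$) if and only if there exist $r$ distinct primes $p_1,\dots,p_r$ such that $c_f(p_j)=0$ for all $1\le j\le r$.
   Context: Let $\tau$ lie in the upper half-plane, $q=e^{2\pi i\tau}$ and $D=\frac{1}{2\pi i}\frac{d}{d\tau}=q\frac{d}{dq}$. For even $k\ge 2$ set $G_k(\tau)=-\frac{B_k}{2k}+\sum_{n\ge 1}\sigma_{k-1}(n)q^n$, where $B_k$ is the $k$-th Bernoulli number and $\sigma_r(n)=\sum_{d\mid n}d^r$. The space $\mathcal{E}$ of quasimodular Eisenstein series is the $\mathbb{C}$-vector space spanned by all $D^\ell G_k$ with $\ell\ge 0$ and $k\ge 2$ even. The set $\widetilde{\Omega}$ consists of the quasimodular forms $f$ for $\mathrm{SL}_2(\mathbb{Z})$ (of possibly mixed weight) with $c_f(p)=0$ for every prime $p$; every element of $\mathcal{E}$ is a quasimodular form. *)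

theory Defs
  imports
    "HOL-Complex_Analysis.Complex_Analysis"
    "HOL-Computational_Algebra.Computational_Algebra"
begin

text \<open>
  A function on the upper half-plane is represented by a function on all of \<open>\<complex>\<close>, of which
  only the values at points of \<open>upper_half_plane\<close> matter.  All notions below depend only on
  these values.
\<close>

definition upper_half_plane :: "complex set" where
  "upper_half_plane = {\<tau>. Im \<tau> > 0}"

definition nome :: "complex \<Rightarrow> complex" where
  "nome \<tau> = exp (2 * of_real pi * \<i> * \<tau>)"

definition qD :: "(complex \<Rightarrow> complex) \<Rightarrow> complex \<Rightarrow> complex" where
  "qD f \<tau> = deriv f \<tau> / (2 * of_real pi * \<i>)"

text \<open>Generating function \<open>x / (exp x - 1) = (\<Sum>n. B\<^sub>n * x^n / n!)\<close>, so \<open>B\<^sub>1 = -1/2\<close>.\<close>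

definition bernoulli_number :: "nat \<Rightarrow> real" where
  "bernoulli_number n = fact n * fps_nth (fps_X / (fps_exp 1 - 1)) n"

definition divisor_sigma :: "nat \<Rightarrow> nat \<Rightarrow> nat" where
  "divisor_sigma s n = (\<Sum>d | d dvd n. d ^ s)"

definition eisenstein_G :: "nat \<Rightarrow> complex \<Rightarrow> complex" where
  "eisenstein_G k \<tau> =
     - of_real (bernoulli_number k) / (2 * of_nat k)
     + (\<Sum>n. of_nat (divisor_sigma (k - 1) (Suc n)) * nome \<tau> ^ Suc n)"

definition quasimodular_eisenstein :: "(complex \<Rightarrow> complex) set" where
  "quasimodular_eisenstein =
     {f. \<exists>(S :: (nat \<times> nat) set) (a :: nat \<times> nat \<Rightarrow> complex).
           finite S \<and> (\<forall>(l, k)\<in>S. even k \<and> 2 \<le> k) \<and>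
           (\<forall>\<tau>\<in>upper_half_plane. f \<tau> = (\<Sum>(l, k)\<in>S. a (l, k) * (qD ^^ l) (eisenstein_G k) \<tau>))}"

definition has_q_expansion :: "(complex \<Rightarrow> complex) \<Rightarrow> (nat \<Rightarrow> complex) \<Rightarrow> bool" where
  "has_q_expansion f c \<longleftrightarrow> (\<forall>\<tau>\<in>upper_half_plane. (\<lambda>n. c n * nome \<tau> ^ n) sums f \<tau>)"

text \<open>
  A \<open>q\<close>-expansion is unique when it exists, and the coefficients are only used for functions
  that have one.
\<close>

definition q_coeff :: "(complex \<Rightarrow> complex) \<Rightarrow> nat \<Rightarrow> complex" where
  "q_coeff f = (THE c. has_q_expansion f c)"

definition bounded_at_ii_inf :: "(complex \<Rightarrow> complex) \<Rightarrow> bool" where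
  "bounded_at_ii_inf g \<longleftrightarrow> (\<exists>B Y. \<forall>\<tau>\<in>upper_half_plane. Im \<tau> \<ge> Y \<longrightarrow> cmod (g \<tau>) \<le> B)"

text \<open>
  Quasimodular forms of weight \<open>k\<close> for the full modular group: there are holomorphic functions
  \<open>g\<^sub>0, \<dots>, g\<^sub>p\<close> with
  \<open>(c\<tau> + d)^(-k) f((a\<tau> + b)/(c\<tau> + d)) = (\<Sum>j\<le>p. g\<^sub>j(\<tau>) (c/(c\<tau> + d))^j)\<close>
  for every matrix \<open>(a b; c d)\<close> of determinant \<open>1\<close>.  The matrices \<open>(1 1; 0 1)\<close> and \<open>(1 0; 0 1)\<close>
  force \<open>f = g\<^sub>0\<close> to be invariant under \<open>\<tau> \<mapsto> \<tau> + 1\<close>, and each \<open>g\<^sub>j\<close> is invariant too, so for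
  them boundedness as \<open>Im \<tau> \<rightarrow> \<infinity>\<close> is holomorphy at the cusp.
\<close>

definition quasimodular_form_of_weight :: "nat \<Rightarrow> (complex \<Rightarrow> complex) \<Rightarrow> bool" where
  "quasimodular_form_of_weight k f \<longleftrightarrow>
     f holomorphic_on upper_half_plane \<and>
     (\<exists>(p :: nat) (g :: nat \<Rightarrow> complex \<Rightarrow> complex).
        (\<forall>j\<le>p. g j holomorphic_on upper_half_plane \<and> bounded_at_ii_inf (g j)) \<and>
        (\<forall>a b c d :: int. a * d - b * c = 1 \<longrightarrow>
           (\<forall>\<tau>\<in>upper_half_plane.
              f ((of_int a * \<tau> + of_int b) / (of_int c * \<tau> + of_int d)) =
              (of_int c * \<tau> + of_int d) ^ k *
              (\<Sum>j\<le>p. g j \<tau> * (of_int c / (of_int c * \<tau> + of_int d)) ^ j))))"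

definition quasimodular_form :: "(complex \<Rightarrow> complex) \<Rightarrow> bool" where
  "quasimodular_form f \<longleftrightarrow>
     (\<exists>(K :: nat) (F :: nat \<Rightarrow> complex \<Rightarrow> complex).
        (\<forall>k\<le>K. quasimodular_form_of_weight k (F k)) \<and>
        (\<forall>\<tau>\<in>upper_half_plane. f \<tau> = (\<Sum>k\<le>K. F k \<tau>)))"

definition Omega_tilde :: "(complex \<Rightarrow> complex) set" where
  "Omega_tilde = {f. quasimodular_form f \<and> (\<forall>p. prime p \<longrightarrow> q_coeff f p = 0)}"

end

theory Submission
  imports Defs
begin

text \<open>
  For prime \<open>p\<close> the coefficient of \<open>D\<^sup>l G\<^sub>k\<close> at \<open>q\<^sup>p\<close> is \<open>p\<^sup>l (1 + p\<^sup>k\<^sup>-\<^sup>1)\<close>, so by linearity there is one polynomial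
  \<open>P\<close> with \<open>c\<^sub>f(p) = P(p)\<close> for every prime \<open>p\<close> (\<open>quasimodular_eisenstein_prime_coeff\<close>).  Since
  \<open>\<bar>P(p)\<bar>\<close> grows like \<open>p\<close> to the power \<open>degree P\<close>, the growth hypothesis forces \<open>degree P \<le> r - 1\<close> unless
  \<open>P = 0\<close>.  Hence \<open>r\<close> distinct prime zeros give \<open>P = 0\<close>, and then every \<open>c\<^sub>f(p)\<close> vanishes
  (\<open>poly_eq_0_of_prime_zeros\<close>).  The other implication holds because there are infinitely many primes.

  Membership in \<open>Omega_tilde\<close> also asserts that \<open>f\<close> is quasimodular, and most of the text proves this.
  As quasimodularity is stable under linear combinations and under \<open>D\<close>, only the transformation
  behaviour of the \<open>G\<^sub>k\<close> themselves is at stake.  It is obtained for all even \<open>k \<ge> 2\<close> at once, including the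
  anomalous case \<open>k = 2\<close>, from one generating function: the logarithmic derivative \<open>Z(\<tau>, z)\<close> in \<open>z\<close> of
  Jacobi's odd theta function.  It has three properties.

  \<^item> It is holomorphic in \<open>z\<close> off the lattice \<open>\<int>\<tau> + \<int>\<close> and satisfies
    \<open>Z(\<tau>, z + m\<tau> + n) = Z(\<tau>, z) - 2\<pi>\<i>m\<close> (\<open>theta_log_deriv_add_period\<close>).

  \<^item> It has the form \<open>1/z + h(z)\<close> near \<open>0\<close> with \<open>h\<close> holomorphic.

  \<^item> For even \<open>k\<close> the coefficient of \<open>z\<^sup>k\<^sup>-\<^sup>1\<close> in \<open>h\<close> is \<open>- 2 (2\<pi>\<i>)\<^sup>k / (k - 1)!\<close> times \<open>G\<^sub>k(\<tau>)\<close>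
    (\<open>theta_reg_fps_nth\<close>).

  Let \<open>\<gamma> = (a b; c d)\<close> and \<open>J = c\<tau> + d\<close>.  Multiplication by \<open>J\<close> maps the lattice of \<open>\<gamma>\<tau>\<close> onto that of \<open>\<tau>\<close>, so
  \<open>Z(\<gamma>\<tau>, z/J)/J - Z(\<tau>, z)\<close> has no poles; by the first property it becomes lattice periodic after subtracting
  the linear function \<open>2\<pi>\<i>cz/J\<close>.  By Liouville's theorem the result is constant.  Comparing coefficients
  of \<open>z\<^sup>k\<^sup>-\<^sup>1\<close> yields \<open>G\<^sub>k(\<gamma>\<tau>) = J\<^sup>k G\<^sub>k(\<tau>)\<close>, where for \<open>k = 2\<close> the linear function contributes the extra
  term (\<open>eisenstein_G_moebius\<close>).
\<close>

section \<open>Power series in \<open>q\<close>\<close>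

lemma norm_nome: "norm (nome \<tau>) = exp (- 2 * pi * Im \<tau>)"
  by (simp add: nome_def norm_exp_eq_Re)

lemma norm_nome_less_1: "\<tau> \<in> upper_half_plane \<Longrightarrow> norm (nome \<tau>) < 1"
  by (simp add: norm_nome upper_half_plane_def)

lemma nome_nonzero [simp]: "nome \<tau> \<noteq> 0"
  by (simp add: nome_def)

lemma nome_add: "nome (x + y) = nome x * nome y"
  by (simp add: nome_def exp_add algebra_simps)

lemma open_upper_half_plane: "open upper_half_plane"
  unfolding upper_half_plane_def by (rule open_halfspace_Im_gt)

lemma ex_nome_eq:
  assumes "x \<noteq> 0" "norm x < 1"
  obtains \<tau> where "\<tau> \<in> upper_half_plane" "nome \<tau> = x"
proof
  define \<tau> where "\<tau> = Ln x / (2 * of_real pi * \<i>)"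
  show "nome \<tau> = x"
    using assms by (simp add: \<tau>_def nome_def)
  hence "exp (- 2 * pi * Im \<tau>) < exp 0"
    using norm_nome[of \<tau>] assms by simp
  thus "\<tau> \<in> upper_half_plane"
    by (simp add: upper_half_plane_def mult_less_0_iff zero_less_mult_iff)
qed

lemma has_field_derivative_nome:
  "(nome has_field_derivative 2 * of_real pi * \<i> * nome \<tau>) (at \<tau>)"
  unfolding nome_def by (auto intro!: derivative_eq_intros)

text \<open>
  The nome maps the upper half-plane onto the punctured unit disc, so a \<open>q\<close>-expansion is a power series
  that converges on the whole disc.
\<close>
lemma has_q_expansion_summable:
  assumes "has_q_expansion f c" "norm x < 1"
  shows "summable (\<lambda>n. c n * x ^ n)"
proof (cases "x = 0")
  case False
  then obtain \<tau> where "\<tau> \<in> upper_half_plane" "nome \<tau> = x"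
    using assms(2) ex_nome_eq by blast
  thus ?thesis
    using assms(1) by (auto simp: has_q_expansion_def sums_iff)
qed (auto simp: summable_0_powser)

lemma has_q_expansion_has_field_derivative:
  assumes "has_q_expansion f c" "\<tau> \<in> upper_half_plane"
  shows "(f has_field_derivative (2 * of_real pi * \<i>) * (\<Sum>n. of_nat n * c n * nome \<tau> ^ n)) (at \<tau>)"
    and "summable (\<lambda>n. of_nat n * c n * nome \<tau> ^ n)"
proof -
  note summ = has_q_expansion_summable[OF assms(1)]
  define q where "q = nome \<tau>"
  have q: "norm q < 1"
    using assms(2) norm_nome_less_1 by (simp add: q_def)
  define D where "D = (\<Sum>n. diffs c n * q ^ n)"
  have "(\<lambda>n. diffs c n * q ^ n) sums D"
    unfolding D_def by (intro summable_sums termdiff_converges[OF q] summ)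
  hence "(\<lambda>n. q * (diffs c n * q ^ n)) sums (q * D)"
    by (rule sums_mult)
  hence "(\<lambda>n. of_nat (Suc n) * c (Suc n) * q ^ Suc n) sums (q * D)"
    by (simp add: diffs_def mult_ac)
  hence qD: "(\<lambda>n. of_nat n * c n * q ^ n) sums (q * D)"
    using sums_Suc_iff[of "\<lambda>n. of_nat n * c n * q ^ n" "q * D"] by simp
  show "summable (\<lambda>n. of_nat n * c n * nome \<tau> ^ n)"
    using qD by (simp add: sums_iff q_def)
  have "((\<lambda>x. \<Sum>n. c n * x ^ n) has_field_derivative D) (at (nome \<tau>))"
    unfolding D_def q_def[symmetric] by (intro termdiffs_strong'[of 1] summ q)
  hence "((\<lambda>\<tau>. \<Sum>n. c n * nome \<tau> ^ n) has_field_derivative (D * (2 * of_real pi * \<i> * nome \<tau>))) (at \<tau>)"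
    by (rule DERIV_chain2[OF _ has_field_derivative_nome])
  hence "(f has_field_derivative (D * (2 * of_real pi * \<i> * nome \<tau>))) (at \<tau>)"
  proof (rule has_field_derivative_transform_within_open[OF _ open_upper_half_plane assms(2)])
    show "(\<Sum>n. c n * nome t ^ n) = f t" if "t \<in> upper_half_plane" for t
      using assms(1) that by (auto simp: has_q_expansion_def sums_iff)
  qed
  also have "D * (2 * of_real pi * \<i> * nome \<tau>) = (2 * of_real pi * \<i>) * (\<Sum>n. of_nat n * c n * nome \<tau> ^ n)"
    using qD by (simp add: sums_iff q_def)
  finally show "(f has_field_derivative (2 * of_real pi * \<i>) * (\<Sum>n. of_nat n * c n * nome \<tau> ^ n)) (at \<tau>)" .
qed

lemma has_q_expansion_qD:
  assumes "has_q_expansion f c"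
  shows "has_q_expansion (qD f) (\<lambda>n. of_nat n * c n)"
  unfolding has_q_expansion_def
proof
  fix \<tau> assume "\<tau> \<in> upper_half_plane"
  note * = has_q_expansion_has_field_derivative[OF assms this]
  have "qD f \<tau> = (\<Sum>n. of_nat n * c n * nome \<tau> ^ n)"
    using DERIV_imp_deriv[OF *(1)] by (simp add: qD_def)
  thus "(\<lambda>n. of_nat n * c n * nome \<tau> ^ n) sums qD f \<tau>"
    using *(2) by (simp add: summable_sums)
qed

lemma has_q_expansion_qD_iterate:
  assumes "has_q_expansion f c"
  shows "has_q_expansion ((qD ^^ l) f) (\<lambda>n. of_nat n ^ l * c n)"
proof (induction l)
  case (Suc l)
  from has_q_expansion_qD[OF this] show ?case by (simp add: mult.assoc)
qed (use assms in simp)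

lemma has_q_expansion_holomorphic:
  assumes "has_q_expansion f c"
  shows "f holomorphic_on upper_half_plane"
  using has_q_expansion_has_field_derivative(1)[OF assms] open_upper_half_plane
  by (auto simp: holomorphic_on_open)

lemma has_q_expansion_sum:
  assumes "\<And>i. i \<in> S \<Longrightarrow> has_q_expansion (f i) (c i)"
    and "\<And>\<tau>. \<tau> \<in> upper_half_plane \<Longrightarrow> h \<tau> = (\<Sum>i\<in>S. a i * f i \<tau>)"
  shows "has_q_expansion h (\<lambda>n. \<Sum>i\<in>S. a i * c i n)"
  unfolding has_q_expansion_def
proof
  fix \<tau> assume \<tau>: "\<tau> \<in> upper_half_plane"
  have "(\<lambda>n. \<Sum>i\<in>S. a i * (c i n * nome \<tau> ^ n)) sums (\<Sum>i\<in>S. a i * f i \<tau>)"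
    using assms(1) \<tau> by (intro sums_sum sums_mult) (auto simp: has_q_expansion_def)
  thus "(\<lambda>n. (\<Sum>i\<in>S. a i * c i n) * nome \<tau> ^ n) sums h \<tau>"
    using assms(2)[OF \<tau>] by (simp add: sum_distrib_right mult.assoc)
qed

text \<open>
  The functions compared below are known to agree only off the origin, because one side involves \<open>1/z\<close> or
  values of the nome, which is never \<open>0\<close>; continuity supplies the value at the origin.
\<close>
lemma fps_expansion_eq_at:
  fixes f g :: "complex \<Rightarrow> complex"
  assumes "f has_fps_expansion F" "g has_fps_expansion G" "eventually (\<lambda>z. f z = g z) (at 0)"
  shows "F = G"
proof -
  have lim: "(\<lambda>z. f z - g z) \<midarrow>0\<rightarrow> f 0 - g 0"
    using has_fps_expansion_imp_continuous[OF assms(1), of UNIV]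
          has_fps_expansion_imp_continuous[OF assms(2), of UNIV]
    by (intro tendsto_diff) (simp_all add: isCont_def)
  have "(\<lambda>z. f z - g z) \<midarrow>0\<rightarrow> 0"
    by (rule tendsto_eventually) (use assms(3) in eventually_elim, simp)
  hence "f 0 - g 0 = 0"
    using lim by (rule LIM_unique[rotated])
  hence "eventually (\<lambda>z. f z = g z) (nhds 0)"
    using assms(3) by (auto simp: eventually_nhds_conv_at)
  hence "f has_fps_expansion F \<longleftrightarrow> g has_fps_expansion F"
    by (rule has_fps_expansion_cong[OF _ refl])
  thus ?thesis
    using assms fps_expansion_unique_complex by blast
qed

lemma has_q_expansion_unique:
  assumes "has_q_expansion f c" "has_q_expansion f c'"
  shows "c = c'"
proof -
  define P where "P = (\<lambda>x. \<Sum>n. (c n - c' n) * x ^ n)"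
  have sums: "(\<lambda>n. (c n - c' n) * x ^ n) sums P x" if "norm x < 1" for x
    unfolding P_def left_diff_distrib
    by (intro summable_sums summable_diff has_q_expansion_summable[OF assms(1) that]
          has_q_expansion_summable[OF assms(2) that])
  have zero: "P x = 0" if x: "norm x < 1" "x \<noteq> 0" for x
  proof -
    obtain \<tau> where \<tau>: "\<tau> \<in> upper_half_plane" "nome \<tau> = x"
      using x ex_nome_eq by blast
    have "(\<lambda>n. c n * x ^ n - c' n * x ^ n) sums (f \<tau> - f \<tau>)"
      using assms \<tau> by (intro sums_diff) (auto simp: has_q_expansion_def)
    thus ?thesis
      using sums[OF x(1)] by (auto simp: left_diff_distrib dest: sums_unique2)
  qed
  have "P has_fps_expansion Abs_fps (\<lambda>n. c n - c' n)"
  proof (rule has_fps_expansionI)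
    show "eventually (\<lambda>u. (\<lambda>n. fps_nth (Abs_fps (\<lambda>n. c n - c' n)) n * u ^ n) sums P u) (nhds 0)"
      using sums eventually_nhds_in_open[of "ball 0 1" "0::complex"] by (auto elim!: eventually_mono)
  qed
  moreover have "(\<lambda>_. 0 :: complex) has_fps_expansion 0"
    by simp
  moreover have "eventually (\<lambda>x. P x = 0) (at 0)"
    using eventually_at_in_open[of "ball 0 1" "0::complex"] zero by (auto elim!: eventually_mono)
  ultimately have "Abs_fps (\<lambda>n. c n - c' n) = 0"
    by (rule fps_expansion_eq_at)
  thus ?thesis
    by (auto simp: fps_eq_iff fun_eq_iff)
qed

lemma q_coeff_eq:
  assumes "has_q_expansion f c"
  shows "q_coeff f = c"
  unfolding q_coeff_def using assms has_q_expansion_unique by blast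

text \<open>
  For \<open>Im \<tau> \<ge> 1\<close> the series is dominated termwise by its absolute values at \<open>q = exp (- 2\<pi>)\<close>.
\<close>
lemma has_q_expansion_bounded:
  assumes "has_q_expansion f c"
  shows "bounded_at_ii_inf f"
proof -
  define \<rho> where "\<rho> = exp (- 2 * pi)"
  have "\<rho> < 1" "\<rho> > 0"
    by (simp_all add: \<rho>_def)
  \<comment> \<open>A point of the disc beyond \<open>\<rho>\<close>: convergence there gives absolute convergence at \<open>\<rho>\<close>.\<close>
  define x :: complex where "x = of_real ((1 + \<rho>) / 2)"
  have "norm x = (1 + \<rho>) / 2"
    unfolding x_def norm_of_real using \<open>\<rho> > 0\<close> by simp
  hence "norm x < 1" "norm (of_real \<rho> :: complex) < norm x"
    using \<open>\<rho> < 1\<close> \<open>\<rho> > 0\<close> by simp_all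
  hence "summable (\<lambda>n. norm (c n * of_real \<rho> ^ n))"
    by (intro powser_insidea[of c x] has_q_expansion_summable[OF assms])
  hence summ: "summable (\<lambda>n. norm (c n) * \<rho> ^ n)"
    using \<open>\<rho> > 0\<close> by (simp add: norm_mult norm_power)
  have "norm (f \<tau>) \<le> (\<Sum>n. norm (c n) * \<rho> ^ n)" if \<tau>: "\<tau> \<in> upper_half_plane" "Im \<tau> \<ge> 1" for \<tau>
  proof -
    have "norm (nome \<tau>) \<le> \<rho>"
      using \<tau> by (simp add: norm_nome \<rho>_def)
    hence le: "norm (c n * nome \<tau> ^ n) \<le> norm (c n) * \<rho> ^ n" for n
      by (simp add: norm_mult norm_power mult_left_mono power_mono)
    have "f \<tau> = (\<Sum>n. c n * nome \<tau> ^ n)"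
      using assms \<tau> by (auto simp: has_q_expansion_def sums_iff)
    also have "norm \<dots> \<le> (\<Sum>n. norm (c n) * \<rho> ^ n)"
      by (rule norm_suminf_le[OF le summ]) 
    finally show ?thesis .
  qed
  thus ?thesis
    unfolding bounded_at_ii_inf_def by blast
qed

text \<open>
  Apply \<open>D\<^sup>s\<close> to the geometric series.
\<close>
lemma summable_power_times_geometric:
  fixes x :: complex
  assumes "norm x < 1"
  shows "summable (\<lambda>n. of_nat n ^ s * x ^ n)"
proof -
  have "has_q_expansion (\<lambda>\<tau>. \<Sum>n. 1 * nome \<tau> ^ n) (\<lambda>_. 1)"
    unfolding has_q_expansion_def
    using norm_nome_less_1 by (auto intro!: summable_sums summable_geometric)
  from has_q_expansion_summable[OF has_q_expansion_qD_iterate[OF this] assms] 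
  show ?thesis by simp
qed

lemma divisor_sigma_le:
  assumes "n > 0"
  shows "divisor_sigma s n \<le> n ^ Suc s"
proof -
  have "divisor_sigma s n \<le> (\<Sum>d\<in>{1..n}. d ^ s)"
    unfolding divisor_sigma_def using assms
    by (intro sum_mono2) (auto dest: dvd_imp_le intro: Nat.gr0I)
  also have "\<dots> \<le> (\<Sum>d\<in>{1..n}. n ^ s)"
    by (intro sum_mono power_mono) auto
  finally show ?thesis by simp
qed

lemma divisor_sigma_series_summable:
  fixes x :: complex
  assumes "norm x < 1"
  shows "summable (\<lambda>n. of_nat (divisor_sigma s (Suc n)) * x ^ Suc n)"
proof (rule summable_comparison_test')
  have "summable (\<lambda>n. of_nat n ^ Suc s * (of_real (norm x) :: complex) ^ n)"
    using assms by (intro summable_power_times_geometric) simp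
  hence "summable (\<lambda>n. of_nat (Suc n) ^ Suc s * (of_real (norm x) :: complex) ^ Suc n)"
    by (subst summable_Suc_iff)
  hence "summable (\<lambda>n. complex_of_real (of_nat (Suc n) ^ Suc s * (norm x) ^ Suc n))"
    by simp
  thus "summable (\<lambda>n. of_nat (Suc n) ^ Suc s * (norm x) ^ Suc n)"
    by (subst (asm) summable_of_real_iff)
  show "norm (of_nat (divisor_sigma s (Suc n)) * x ^ Suc n) \<le> of_nat (Suc n) ^ Suc s * (norm x) ^ Suc n"
    for n
  proof -
    have "real (divisor_sigma s (Suc n)) \<le> real (Suc n ^ Suc s)"
      unfolding of_nat_le_iff by (rule divisor_sigma_le) simp
    hence "real (divisor_sigma s (Suc n)) * norm x ^ Suc n \<le> real (Suc n) ^ Suc s * norm x ^ Suc n"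
      by (intro mult_right_mono) (simp_all only: of_nat_power zero_le_power norm_ge_zero)
    thus ?thesis
      by (simp only: norm_mult norm_power norm_of_nat)
  qed
qed

definition eisenstein_coeff :: "nat \<Rightarrow> nat \<Rightarrow> complex" where
  "eisenstein_coeff k n =
     (if n = 0 then - of_real (bernoulli_number k) / (2 * of_nat k)
      else of_nat (divisor_sigma (k - 1) n))"

lemma eisenstein_G_has_q_expansion: "has_q_expansion (eisenstein_G k) (eisenstein_coeff k)"
  unfolding has_q_expansion_def
proof
  fix \<tau> assume "\<tau> \<in> upper_half_plane"
  hence "(\<lambda>n. of_nat (divisor_sigma (k - 1) (Suc n)) * nome \<tau> ^ Suc n) sums
           (eisenstein_G k \<tau> - eisenstein_coeff k 0)"
    unfolding eisenstein_G_def eisenstein_coeff_def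
    using summable_sums[OF divisor_sigma_series_summable[of "nome \<tau>"]] norm_nome_less_1 by simp
  hence "(\<lambda>n. eisenstein_coeff k (Suc n) * nome \<tau> ^ Suc n) sums
           (eisenstein_G k \<tau> - eisenstein_coeff k 0)"
    by (simp add: eisenstein_coeff_def)
  thus "(\<lambda>n. eisenstein_coeff k n * nome \<tau> ^ n) sums eisenstein_G k \<tau>"
    by (subst (asm) sums_Suc_iff) simp
qed

section \<open>Quasimodular forms of a fixed weight\<close>

lemma automorphy_factor_nonzero:
  assumes "\<tau> \<in> upper_half_plane" "a * d - b * c = (1::int)"
  shows "of_int c * \<tau> + of_int d \<noteq> (0::complex)"
proof
  assume 0: "of_int c * \<tau> + of_int d = 0"
  hence "of_int c * Im \<tau> = 0"
    by (auto simp: complex_eq_iff)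
  hence "c = 0"
    using assms(1) by (simp add: upper_half_plane_def)
  with 0 have "d = 0" by simp
  with \<open>c = 0\<close> assms(2) show False by simp
qed

lemma moebius_in_upper_half_plane:
  assumes "\<tau> \<in> upper_half_plane" "a * d - b * c = (1::int)"
  shows "(of_int a * \<tau> + of_int b) / (of_int c * \<tau> + of_int d) \<in> upper_half_plane"
proof -
  define J where "J = of_int c * \<tau> + of_int d"
  have J: "J \<noteq> 0"
    unfolding J_def by (rule automorphy_factor_nonzero) fact+
  have "Im ((of_int a * \<tau> + of_int b) * cnj J) = (of_int (a * d - b * c)) * Im \<tau>"
    by (simp add: J_def algebra_simps)
  hence "Im ((of_int a * \<tau> + of_int b) / J) = Im \<tau> / (cmod J)\<^sup>2"
    by (simp add: complex_div_cnj[of _ J] assms(2) del: complex_cnj_add flip: of_real_power)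
  thus ?thesis
    using assms(1) J by (simp add: upper_half_plane_def J_def)
qed

lemma moebius_has_field_derivative:
  assumes "\<tau> \<in> upper_half_plane" "a * d - b * c = (1::int)"
  shows "((\<lambda>\<tau>. (of_int a * \<tau> + of_int b) / (of_int c * \<tau> + of_int d)) has_field_derivative
            1 / (of_int c * \<tau> + of_int d) ^ 2) (at \<tau>)"
proof -
  note J = automorphy_factor_nonzero[OF assms]
  have "complex_of_int a * of_int d - of_int b * of_int c = 1"
    using arg_cong[OF assms(2), of complex_of_int] by simp
  hence "of_int a * (of_int c * \<tau> + of_int d) - (of_int a * \<tau> + of_int b) * of_int c = 1"
    by (simp add: algebra_simps)
  thus ?thesis
    using J by (auto intro!: derivative_eq_intros simp: power2_eq_square)
qed

text \<open>
  Extending the component functions by zero makes the degree bound \<open>p\<close> adjustable, so that two forms can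
  be given a common bound and shifted indices need no case distinction.
\<close>
lemma quasimodular_form_of_weightE:
  assumes "quasimodular_form_of_weight k f"
  obtains p g where
    "\<And>j. g j holomorphic_on upper_half_plane" "\<And>j. bounded_at_ii_inf (g j)"
    "\<And>j. j > p \<Longrightarrow> g j = (\<lambda>_. 0)"
    "\<And>a b c d \<tau> P. a * d - b * c = 1 \<Longrightarrow> \<tau> \<in> upper_half_plane \<Longrightarrow> P \<ge> p \<Longrightarrow>
       f ((of_int a * \<tau> + of_int b) / (of_int c * \<tau> + of_int d)) =
         (of_int c * \<tau> + of_int d) ^ k * (\<Sum>j\<le>P. g j \<tau> * (of_int c / (of_int c * \<tau> + of_int d)) ^ j)"
proof -
  from assms obtain p g where pg:
    "\<forall>j\<le>p. g j holomorphic_on upper_half_plane \<and> bounded_at_ii_inf (g j)"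
    "\<forall>a b c d :: int. a * d - b * c = 1 \<longrightarrow> (\<forall>\<tau>\<in>upper_half_plane.
       f ((of_int a * \<tau> + of_int b) / (of_int c * \<tau> + of_int d)) =
         (of_int c * \<tau> + of_int d) ^ k * (\<Sum>j\<le>p. g j \<tau> * (of_int c / (of_int c * \<tau> + of_int d)) ^ j))"
    unfolding quasimodular_form_of_weight_def by (elim conjE exE)
  define g' where "g' = (\<lambda>j. if j \<le> p then g j else (\<lambda>_. 0))"
  show thesis
  proof (rule that[of g' p])
    show "g' j holomorphic_on upper_half_plane" "bounded_at_ii_inf (g' j)" for j
      using pg(1) by (auto simp: g'_def bounded_at_ii_inf_def)
  next
    fix a b c d :: int and \<tau> :: complex and P :: nat
    assume *: "a * d - b * c = 1" "\<tau> \<in> upper_half_plane" "P \<ge> p"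
    have "(\<Sum>j\<le>P. g' j \<tau> * x ^ j) = (\<Sum>j\<le>p. g j \<tau> * x ^ j)" for x
      using *(3) by (intro sum.mono_neutral_cong_right) (auto simp: g'_def)
    thus "f ((of_int a * \<tau> + of_int b) / (of_int c * \<tau> + of_int d)) =
         (of_int c * \<tau> + of_int d) ^ k * (\<Sum>j\<le>P. g' j \<tau> * (of_int c / (of_int c * \<tau> + of_int d)) ^ j)"
      unfolding pg(2)[rule_format, OF *(1,2)] by simp
  qed (auto simp: g'_def)
qed

lemma quasimodular_form_of_weightI:
  assumes "f holomorphic_on upper_half_plane"
    and "\<And>j. g j holomorphic_on upper_half_plane" "\<And>j. bounded_at_ii_inf (g j)"
    and "\<And>a b c d \<tau>. a * d - b * c = 1 \<Longrightarrow> \<tau> \<in> upper_half_plane \<Longrightarrow>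
       f ((of_int a * \<tau> + of_int b) / (of_int c * \<tau> + of_int d)) =
         (of_int c * \<tau> + of_int d) ^ k * (\<Sum>j\<le>p. g j \<tau> * (of_int c / (of_int c * \<tau> + of_int d)) ^ j)"
  shows "quasimodular_form_of_weight k f"
  unfolding quasimodular_form_of_weight_def using assms by blast

lemma bounded_at_ii_inf_add:
  assumes "bounded_at_ii_inf f" "bounded_at_ii_inf g"
  shows "bounded_at_ii_inf (\<lambda>\<tau>. f \<tau> + g \<tau>)"
proof -
  obtain B Y B' Y' where 
    "\<And>\<tau>. \<tau> \<in> upper_half_plane \<Longrightarrow> Im \<tau> \<ge> Y \<Longrightarrow> norm (f \<tau>) \<le> B"
    "\<And>\<tau>. \<tau> \<in> upper_half_plane \<Longrightarrow> Im \<tau> \<ge> Y' \<Longrightarrow> norm (g \<tau>) \<le> B'"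
    using assms unfolding bounded_at_ii_inf_def by metis
  hence "norm (f \<tau> + g \<tau>) \<le> B + B'" if "\<tau> \<in> upper_half_plane" "Im \<tau> \<ge> max Y Y'" for \<tau>
    using that by (intro norm_triangle_le add_mono) auto
  thus ?thesis
    unfolding bounded_at_ii_inf_def by blast
qed

lemma bounded_at_ii_inf_cmult:
  assumes "bounded_at_ii_inf f"
  shows "bounded_at_ii_inf (\<lambda>\<tau>. c * f \<tau>)"
proof -
  obtain B Y where "\<And>\<tau>. \<tau> \<in> upper_half_plane \<Longrightarrow> Im \<tau> \<ge> Y \<Longrightarrow> norm (f \<tau>) \<le> B"
    using assms unfolding bounded_at_ii_inf_def by metis
  hence "norm (c * f \<tau>) \<le> norm c * B" if "\<tau> \<in> upper_half_plane" "Im \<tau> \<ge> Y" for \<tau>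
    using that by (simp add: norm_mult mult_left_mono)
  thus ?thesis
    unfolding bounded_at_ii_inf_def by blast
qed

text \<open>
  Cauchy's estimate on the disc of radius \<open>1\<close> about a point that lies at height \<open>1\<close> above the region of
  boundedness.
\<close>
lemma bounded_at_ii_inf_deriv:
  assumes "f holomorphic_on upper_half_plane" "bounded_at_ii_inf f"
  shows "bounded_at_ii_inf (deriv f)"
proof -
  obtain B Y where B: "\<And>\<tau>. \<tau> \<in> upper_half_plane \<Longrightarrow> Im \<tau> \<ge> Y \<Longrightarrow> norm (f \<tau>) \<le> B"
    using assms unfolding bounded_at_ii_inf_def by metis
  have "norm (deriv f \<tau>) \<le> B" if \<tau>: "\<tau> \<in> upper_half_plane" "Im \<tau> \<ge> max Y 1 + 1" for \<tau>
  proof -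
    have x: "x \<in> upper_half_plane" "Im x \<ge> Y" if "norm (\<tau> - x) \<le> 1" for x
      using abs_Im_le_cmod[of "\<tau> - x"] \<tau> that by (auto simp: upper_half_plane_def)
    have sub: "cball \<tau> 1 \<subseteq> upper_half_plane"
      using x by (auto simp: dist_norm)
    have "norm ((deriv ^^ 1) f \<tau>) \<le> fact 1 * B / 1 ^ 1"
      using sub B x assms(1)
      by (intro Cauchy_inequality)
         (auto intro!: holomorphic_on_imp_continuous_on elim: holomorphic_on_subset
            simp: subset_iff)
    thus ?thesis by simp
  qed
  thus ?thesis
    unfolding bounded_at_ii_inf_def by blast
qed

lemma quasimodular_form_of_weight_0: "quasimodular_form_of_weight k (\<lambda>_. 0)"
  by (rule quasimodular_form_of_weightI[where g = "\<lambda>_ _. 0"]) (auto simp: bounded_at_ii_inf_def)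

lemma quasimodular_form_of_weight_add:
  assumes "quasimodular_form_of_weight k f1" "quasimodular_form_of_weight k f2"
  shows "quasimodular_form_of_weight k (\<lambda>\<tau>. f1 \<tau> + f2 \<tau>)"
proof -
  from assms(1) obtain p1 g1 where 1: 
    "\<And>j. g1 j holomorphic_on upper_half_plane" "\<And>j. bounded_at_ii_inf (g1 j)"
    "\<And>a b c d \<tau> P. a * d - b * c = 1 \<Longrightarrow> \<tau> \<in> upper_half_plane \<Longrightarrow> P \<ge> p1 \<Longrightarrow>
       f1 ((of_int a * \<tau> + of_int b) / (of_int c * \<tau> + of_int d)) =
         (of_int c * \<tau> + of_int d) ^ k * (\<Sum>j\<le>P. g1 j \<tau> * (of_int c / (of_int c * \<tau> + of_int d)) ^ j)"
    by (rule quasimodular_form_of_weightE) blast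
  from assms(2) obtain p2 g2 where 2: 
    "\<And>j. g2 j holomorphic_on upper_half_plane" "\<And>j. bounded_at_ii_inf (g2 j)"
    "\<And>a b c d \<tau> P. a * d - b * c = 1 \<Longrightarrow> \<tau> \<in> upper_half_plane \<Longrightarrow> P \<ge> p2 \<Longrightarrow>
       f2 ((of_int a * \<tau> + of_int b) / (of_int c * \<tau> + of_int d)) =
         (of_int c * \<tau> + of_int d) ^ k * (\<Sum>j\<le>P. g2 j \<tau> * (of_int c / (of_int c * \<tau> + of_int d)) ^ j)"
    by (rule quasimodular_form_of_weightE) blast
  show ?thesis
  proof (rule quasimodular_form_of_weightI[where g = "\<lambda>j \<tau>. g1 j \<tau> + g2 j \<tau>" and p = "max p1 p2"])
    show "(\<lambda>\<tau>. f1 \<tau> + f2 \<tau>) holomorphic_on upper_half_plane"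
      using assms by (intro holomorphic_intros) (auto simp: quasimodular_form_of_weight_def)
  next
    fix a b c d :: int and \<tau> :: complex
    assume *: "a * d - b * c = 1" "\<tau> \<in> upper_half_plane"
    show "f1 ((of_int a * \<tau> + of_int b) / (of_int c * \<tau> + of_int d)) +
          f2 ((of_int a * \<tau> + of_int b) / (of_int c * \<tau> + of_int d)) =
         (of_int c * \<tau> + of_int d) ^ k *
         (\<Sum>j\<le>max p1 p2. (g1 j \<tau> + g2 j \<tau>) * (of_int c / (of_int c * \<tau> + of_int d)) ^ j)"
      unfolding 1(3)[OF * max.cobounded1[of p1 p2]] 2(3)[OF * max.cobounded2[of p2 p1]]
      by (simp only: distrib_right sum.distrib distrib_left)
  qed (use 1(1,2) 2(1,2) in \<open>auto intro!: holomorphic_intros bounded_at_ii_inf_add\<close>)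
qed

lemma quasimodular_form_of_weight_cmult:
  assumes "quasimodular_form_of_weight k f"
  shows "quasimodular_form_of_weight k (\<lambda>\<tau>. x * f \<tau>)"
proof -
  from assms obtain p g where 1: 
    "\<And>j. g j holomorphic_on upper_half_plane" "\<And>j. bounded_at_ii_inf (g j)"
    "\<And>a b c d \<tau> P. a * d - b * c = 1 \<Longrightarrow> \<tau> \<in> upper_half_plane \<Longrightarrow> P \<ge> p \<Longrightarrow>
       f ((of_int a * \<tau> + of_int b) / (of_int c * \<tau> + of_int d)) =
         (of_int c * \<tau> + of_int d) ^ k * (\<Sum>j\<le>P. g j \<tau> * (of_int c / (of_int c * \<tau> + of_int d)) ^ j)"
    by (rule quasimodular_form_of_weightE) blast
  show ?thesis
  proof (rule quasimodular_form_of_weightI[where g = "\<lambda>j \<tau>. x * g j \<tau>" and p = p])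
    show "(\<lambda>\<tau>. x * f \<tau>) holomorphic_on upper_half_plane"
      using assms by (intro holomorphic_intros) (auto simp: quasimodular_form_of_weight_def)
  next
    fix a b c d :: int and \<tau> :: complex
    assume "a * d - b * c = 1" "\<tau> \<in> upper_half_plane"
    from 1(3)[OF this order_refl]
    show "x * f ((of_int a * \<tau> + of_int b) / (of_int c * \<tau> + of_int d)) =
         (of_int c * \<tau> + of_int d) ^ k * (\<Sum>j\<le>p. x * g j \<tau> * (of_int c / (of_int c * \<tau> + of_int d)) ^ j)"
      by (simp only: mult.assoc mult.left_commute[of x "_ ^ k"] flip: sum_distrib_left)
  qed (use 1 in \<open>auto intro!: holomorphic_intros bounded_at_ii_inf_cmult\<close>)
qed

lemma quasimodular_form_of_weight_sum:
  assumes "\<And>i. i \<in> S \<Longrightarrow> quasimodular_form_of_weight k (f i)"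
  shows "quasimodular_form_of_weight k (\<lambda>\<tau>. \<Sum>i\<in>S. x i * f i \<tau>)"
  using assms
proof (induction S rule: infinite_finite_induct)
  case (insert i S)
  thus ?case
    by (auto intro!: quasimodular_form_of_weight_add quasimodular_form_of_weight_cmult)
qed (auto simp: quasimodular_form_of_weight_0)

text \<open>
  Write \<open>J = c\<tau> + d\<close> and \<open>X = c/J\<close>, so that \<open>J' = XJ\<close>, \<open>X' = - X\<^sup>2\<close> and \<open>\<gamma>' = 1/J\<^sup>2\<close>.  Differentiating
  \<open>f(\<gamma>\<tau>) = J\<^sup>k (\<Sum>j. g\<^sub>j X\<^sup>j)\<close> therefore gives \<open>f'(\<gamma>\<tau>) = J\<^sup>k\<^sup>+\<^sup>2 (\<Sum>j. (g\<^sub>j' + (k - j + 1) g\<^sub>j\<^sub>-\<^sub>1) X\<^sup>j)\<close>: the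
  weight rises by \<open>2\<close> and the degree in \<open>X\<close> by \<open>1\<close>.
\<close>
lemma quasimodular_form_of_weight_qD:
  assumes "quasimodular_form_of_weight k f"
  shows "quasimodular_form_of_weight (k + 2) (qD f)"
proof -
  from assms obtain p g where
    g: "\<And>j. g j holomorphic_on upper_half_plane" "\<And>j. bounded_at_ii_inf (g j)" and
    gp: "\<And>j. j > p \<Longrightarrow> g j = (\<lambda>_. 0)" and
    f: "\<And>a b c d \<tau> P. a * d - b * c = 1 \<Longrightarrow> \<tau> \<in> upper_half_plane \<Longrightarrow> P \<ge> p \<Longrightarrow>
       f ((of_int a * \<tau> + of_int b) / (of_int c * \<tau> + of_int d)) =
         (of_int c * \<tau> + of_int d) ^ k * (\<Sum>j\<le>P. g j \<tau> * (of_int c / (of_int c * \<tau> + of_int d)) ^ j)"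
    by (rule quasimodular_form_of_weightE) blast
  have f_hol: "f holomorphic_on upper_half_plane"
    using assms by (simp add: quasimodular_form_of_weight_def)
  define G where "G = (\<lambda>j \<tau>. 1 / (2 * of_real pi * \<i>) * (deriv (g j) \<tau> +
      (if j = 0 then 0 else (of_nat k - of_nat j + 1)) * g (j - 1) \<tau>))"
  show ?thesis
  proof (rule quasimodular_form_of_weightI[where g = G and p = "Suc p"])
    show "qD f holomorphic_on upper_half_plane"
      unfolding qD_def by (intro holomorphic_intros f_hol open_upper_half_plane) auto
  next
    fix j
    show "G j holomorphic_on upper_half_plane"
      unfolding G_def by (intro holomorphic_intros g open_upper_half_plane) auto
    show "bounded_at_ii_inf (G j)"
      unfolding G_def
      by (intro bounded_at_ii_inf_add bounded_at_ii_inf_cmult bounded_at_ii_inf_deriv g)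
  next
    fix a b c d :: int and \<tau> :: complex
    assume det: "a * d - b * c = 1" and \<tau>: "\<tau> \<in> upper_half_plane"
    define J where "J = of_int c * \<tau> + of_int d"
    define X where "X = of_int c / J"
    define \<gamma> where "\<gamma> = (\<lambda>\<tau>::complex. (of_int a * \<tau> + of_int b) / (of_int c * \<tau> + of_int d))"
    have J: "J \<noteq> 0"
      unfolding J_def using automorphy_factor_nonzero[OF \<tau> det] .
    have cX: "of_int c = X * J"
      using J by (simp add: X_def)
    have \<gamma>: "\<gamma> \<tau> \<in> upper_half_plane"
      unfolding \<gamma>_def by (rule moebius_in_upper_half_plane) fact+
    have "(f has_field_derivative deriv f (\<gamma> \<tau>)) (at (\<gamma> \<tau>))"
      using f_hol \<gamma> open_upper_half_plane holomorphic_derivI by blast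
    moreover have "(\<gamma> has_field_derivative 1 / J ^ 2) (at \<tau>)"
      unfolding \<gamma>_def J_def by (rule moebius_has_field_derivative) fact+
    ultimately have lhs: "((\<lambda>t. f (\<gamma> t)) has_field_derivative deriv f (\<gamma> \<tau>) * (1 / J ^ 2)) (at \<tau>)"
      by (rule DERIV_chain2)
    have dJ: "((\<lambda>t. (of_int c * t + of_int d) ^ k) has_field_derivative of_nat k * X * J ^ k) (at \<tau>)"
    proof -
      have "((\<lambda>t. (of_int c * t + of_int d) ^ k) has_field_derivative of_nat k * of_int c * J ^ (k - 1)) (at \<tau>)"
        unfolding J_def by (auto intro!: derivative_eq_intros)
      also have "of_nat k * of_int c * J ^ (k - 1) = of_nat k * X * J ^ k"
        by (cases k) (simp_all add: cX)
      finally show ?thesis .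
    qed
    have dX: "((\<lambda>t. (of_int c / (of_int c * t + of_int d))) has_field_derivative - (X ^ 2)) (at \<tau>)"
      using J unfolding J_def X_def by (auto intro!: derivative_eq_intros simp: power2_eq_square)
    have dXj: "((\<lambda>t. (of_int c / (of_int c * t + of_int d)) ^ j) has_field_derivative
                  - of_nat j * X ^ Suc j) (at \<tau>)" for j
    proof -
      have "((\<lambda>t. (of_int c / (of_int c * t + of_int d)) ^ j) has_field_derivative
                  of_nat j * (- (X ^ 2)) * X ^ (j - 1)) (at \<tau>)"
        using DERIV_power[OF dX, of j] unfolding X_def J_def by (simp add: mult_ac)
      also have "of_nat j * (- (X ^ 2)) * X ^ (j - 1) = - of_nat j * X ^ Suc j"
        by (cases j) (simp_all add: power2_eq_square algebra_simps)
      finally show ?thesis .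
    qed
    have dg: "(g j has_field_derivative deriv (g j) \<tau>) (at \<tau>)" for j
      using g(1) \<tau> open_upper_half_plane holomorphic_derivI by blast
    have d0: "((\<lambda>t. (of_int c * t + of_int d) ^ k *
              (\<Sum>j\<le>p. g j t * (of_int c / (of_int c * t + of_int d)) ^ j)) has_field_derivative
            (of_nat k * X * J ^ k) * (\<Sum>j\<le>p. g j \<tau> * X ^ j) +
            (\<Sum>j\<le>p. deriv (g j) \<tau> * X ^ j + (- of_nat j * X ^ Suc j) * g j \<tau>) * J ^ k) (at \<tau>)"
      unfolding X_def J_def
      by (intro DERIV_mult DERIV_sum dg dJ[unfolded X_def J_def] dXj[unfolded X_def J_def])
    have ev: "eventually (\<lambda>t. (of_int c * t + of_int d) ^ k *
              (\<Sum>j\<le>p. g j t * (of_int c / (of_int c * t + of_int d)) ^ j) = f (\<gamma> t)) (nhds \<tau>)"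
      using eventually_nhds_in_open[OF open_upper_half_plane \<tau>]
      by eventually_elim (simp only: \<gamma>_def f[OF det _ order_refl])
    have rhs: "((\<lambda>t. f (\<gamma> t)) has_field_derivative
            (of_nat k * X * J ^ k) * (\<Sum>j\<le>p. g j \<tau> * X ^ j) +
            (\<Sum>j\<le>p. deriv (g j) \<tau> * X ^ j + (- of_nat j * X ^ Suc j) * g j \<tau>) * J ^ k) (at \<tau>)"
      by (rule iffD1[OF DERIV_cong_ev[OF refl ev refl] d0])
    have "deriv f (\<gamma> \<tau>) * (1 / J ^ 2) = (of_nat k * X * J ^ k) * (\<Sum>j\<le>p. g j \<tau> * X ^ j) +
            (\<Sum>j\<le>p. deriv (g j) \<tau> * X ^ j + (- of_nat j * X ^ Suc j) * g j \<tau>) * J ^ k"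
      using DERIV_unique[OF lhs rhs] .
    also have "\<dots> = J ^ k * ((\<Sum>j\<le>p. deriv (g j) \<tau> * X ^ j) +
                             (\<Sum>j\<le>p. (of_nat k - of_nat j) * g j \<tau> * X ^ Suc j))"
      by (simp add: sum_distrib_left sum_distrib_right algebra_simps sum.distrib sum_negf
            sum_subtractf)
    also have "(\<Sum>j\<le>p. deriv (g j) \<tau> * X ^ j) = (\<Sum>j\<le>Suc p. deriv (g j) \<tau> * X ^ j)"
      by (simp add: gp)
    also have "(\<Sum>j\<le>p. (of_nat k - of_nat j) * g j \<tau> * X ^ Suc j) =
               (\<Sum>j\<le>Suc p. (if j = 0 then 0 else (of_nat k - of_nat j + 1)) * g (j - 1) \<tau> * X ^ j)"
      by (subst sum.atMost_Suc_shift) simp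
    also have "(\<Sum>j\<le>Suc p. deriv (g j) \<tau> * X ^ j) + \<dots> =
                 (\<Sum>j\<le>Suc p. (2 * of_real pi * \<i>) * (G j \<tau> * X ^ j))"
      unfolding G_def sum.distrib[symmetric] by (intro sum.cong) (auto simp: algebra_simps)
    finally have "deriv f (\<gamma> \<tau>) * (1 / J ^ 2) =
                    J ^ k * ((2 * of_real pi * \<i>) * (\<Sum>j\<le>Suc p. G j \<tau> * X ^ j))"
      by (simp only: sum_distrib_left)
    moreover define S where "S = (\<Sum>j\<le>Suc p. G j \<tau> * X ^ j)"
    ultimately have "deriv f (\<gamma> \<tau>) / (2 * of_real pi * \<i>) = J ^ (k + 2) * S"
      using J by (simp add: field_simps power_add power2_eq_square)
    thus "qD f ((of_int a * \<tau> + of_int b) / (of_int c * \<tau> + of_int d)) =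
            (of_int c * \<tau> + of_int d) ^ (k + 2) *
            (\<Sum>j\<le>Suc p. G j \<tau> * (of_int c / (of_int c * \<tau> + of_int d)) ^ j)"
      unfolding qD_def \<gamma>_def S_def X_def J_def .
  qed
qed

lemma quasimodular_form_of_weight_qD_iterate:
  assumes "quasimodular_form_of_weight k f"
  shows "quasimodular_form_of_weight (k + 2 * l) ((qD ^^ l) f)"
proof (induction l)
  case (Suc l)
  from quasimodular_form_of_weight_qD[OF this] show ?case by (simp add: add.commute)
qed (use assms in simp)

section \<open>A Lambert series and its continuation to the plane\<close>

text \<open>
  For \<open>\<bar>q\<bar> < 1\<close> and \<open>\<bar>v\<bar> < 1\<close> this is also \<open>\<Sum>m. q\<^sup>m v / (1 - q\<^sup>m v)\<close>, which shows the poles of its continuation;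
  the form chosen here is a power series in \<open>v\<close>, so holomorphy on the disc is immediate.
\<close>
definition lambert_gen :: "complex \<Rightarrow> complex \<Rightarrow> complex" where
  "lambert_gen q v = (\<Sum>n. v ^ Suc n / (1 - q ^ Suc n))"

lemma norm_power_Suc_le:
  fixes q :: complex
  assumes "norm q < 1"
  shows "norm (q ^ Suc n) \<le> norm q"
  using assms by (simp add: norm_power norm_mult mult_left_le power_le_one)

lemma norm_inverse_one_minus_power_le:
  fixes q :: complex
  assumes "norm q < 1"
  shows "norm (1 / (1 - q ^ Suc n)) \<le> 1 / (1 - norm q)"
proof -
  have "1 - norm q \<le> norm (1 - q ^ Suc n)"
    using norm_triangle_ineq2[of 1 "q ^ Suc n"] norm_power_Suc_le[OF assms, of n] by simp
  thus ?thesis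
    using assms by (simp add: norm_divide frac_le)
qed

lemma lambert_gen_sums:
  assumes "norm q < 1" "norm v < 1"
  shows "(\<lambda>n. v ^ Suc n / (1 - q ^ Suc n)) sums lambert_gen q v"
proof -
  have "summable (\<lambda>n. v ^ Suc n / (1 - q ^ Suc n))"
  proof (rule summable_comparison_test', rule summable_mult2)
    show "summable (\<lambda>n. norm v ^ Suc n)"
      using assms summable_geometric[of "norm v"] by (subst summable_Suc_iff) auto
    show "norm (v ^ Suc n / (1 - q ^ Suc n)) \<le> norm v ^ Suc n * (1 / (1 - norm q))" if "n \<ge> 0" for n
    proof -
      have "norm (v ^ Suc n / (1 - q ^ Suc n)) = norm v ^ Suc n * norm (1 / (1 - q ^ Suc n))"
        by (simp add: norm_divide norm_mult norm_power)
      also have "\<dots> \<le> norm v ^ Suc n * (1 / (1 - norm q))"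
        by (intro mult_left_mono norm_inverse_one_minus_power_le assms) auto
      finally show ?thesis .
    qed
  qed
  thus ?thesis
    unfolding lambert_gen_def by (rule summable_sums)
qed

lemma lambert_gen_holomorphic:
  assumes "norm q < 1"
  shows "lambert_gen q holomorphic_on ball 0 1"
proof (rule power_series_holomorphic[where a = "\<lambda>n. if n = 0 then 0 else 1 / (1 - q ^ n)"])
  fix v :: complex assume "v \<in> ball 0 1"
  hence "(\<lambda>n. v ^ Suc n / (1 - q ^ Suc n)) sums lambert_gen q v"
    using assms by (intro lambert_gen_sums) auto
  thus "(\<lambda>n. (if n = 0 then 0 else 1 / (1 - q ^ n)) * (v - 0) ^ n) sums lambert_gen q v"
    using sums_Suc_iff[of "\<lambda>n. (if n = 0 then 0 else 1 / (1 - q ^ n)) * (v - 0) ^ n" "lambert_gen q v"] by simp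
qed

text \<open>
  Subtracting the two power series cancels the denominators and leaves a geometric series.
\<close>
lemma lambert_gen_functional_equation:
  assumes "norm q < 1" "norm v < 1"
  shows "lambert_gen q v = v / (1 - v) + lambert_gen q (q * v)"
proof -
  have qv: "norm (q * v) < 1"
    using assms mult_left_le_one_le[of "norm v" "norm q"] by (simp add: norm_mult)
  have "(\<lambda>n. v ^ Suc n / (1 - q ^ Suc n) - (q * v) ^ Suc n / (1 - q ^ Suc n))
          sums (lambert_gen q v - lambert_gen q (q * v))"
    using assms qv by (intro sums_diff lambert_gen_sums)
  also have "(\<lambda>n. v ^ Suc n / (1 - q ^ Suc n) - (q * v) ^ Suc n / (1 - q ^ Suc n)) = (\<lambda>n. v * v ^ n)"
  proof
    fix n
    have "norm (q ^ Suc n) < 1"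
      using norm_power_Suc_le[OF assms(1), of n] assms(1) by simp
    hence "1 - q ^ Suc n \<noteq> 0"
      by auto
    moreover have "v ^ Suc n - (q * v) ^ Suc n = (1 - q ^ Suc n) * v ^ Suc n"
      by (simp add: power_mult_distrib algebra_simps)
    ultimately show "v ^ Suc n / (1 - q ^ Suc n) - (q * v) ^ Suc n / (1 - q ^ Suc n) = v * v ^ n"
      unfolding diff_divide_distrib[symmetric] by simp
  qed
  finally have "(\<lambda>n. v * v ^ n) sums (lambert_gen q v - lambert_gen q (q * v))" .
  moreover have "(\<lambda>n. v * v ^ n) sums (v * (1 / (1 - v)))"
    using assms by (intro sums_mult geometric_sums)
  ultimately have "lambert_gen q v - lambert_gen q (q * v) = v * (1 / (1 - v))"
    using sums_unique2 by blast
  thus ?thesis by (simp add: algebra_simps)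
qed

text \<open>
  The continuation of \<open>lambert_gen q\<close> to the plane: its functional equation is applied until the argument lies
  in the unit disc.
\<close>
definition lambert_ext :: "complex \<Rightarrow> complex \<Rightarrow> complex" where
  "lambert_ext q w =
     (let M = (LEAST M. norm (q ^ M * w) < 1)
      in (\<Sum>m<M. q ^ m * w / (1 - q ^ m * w)) + lambert_gen q (q ^ M * w))"

lemma ex_power_times_small:
  fixes q w :: complex
  assumes "norm q < 1"
  shows "\<exists>M. norm (q ^ M * w) < 1"
proof -
  have "(\<lambda>M. q ^ M * w) \<longlonglongrightarrow> 0 * w"
    by (intro tendsto_intros LIMSEQ_power_zero assms)
  hence "eventually (\<lambda>M. norm (q ^ M * w) < 1) sequentially"
    using order_tendstoD(2)[OF tendsto_norm_zero, of "\<lambda>M. q ^ M * w"] by simp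
  thus ?thesis by (rule eventually_happens'[rotated]) auto
qed

text \<open>
  The choice of \<open>M\<close> is immaterial, since one more step of the functional equation changes nothing.  This
  freedom is what makes the formula usable on a whole neighbourhood with a fixed \<open>M\<close>.
\<close>
lemma lambert_ext_eq:
  assumes q: "norm q < 1" and M: "norm (q ^ M * w) < 1"
  shows "lambert_ext q w = (\<Sum>m<M. q ^ m * w / (1 - q ^ m * w)) + lambert_gen q (q ^ M * w)"
proof -
  define L where "L = (LEAST M. norm (q ^ M * w) < 1)"
  define S where "S = (\<lambda>M. (\<Sum>m<M. q ^ m * w / (1 - q ^ m * w)) + lambert_gen q (q ^ M * w))"
  have L: "norm (q ^ L * w) < 1" "L \<le> M"
    using M unfolding L_def by (auto intro: LeastI Least_le)
  have "norm (q ^ N * w) < 1 \<and> S N = S L" if "N \<ge> L" for N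
    using that
  proof (induction N rule: dec_induct)
    case (step N)
    have "norm (q ^ Suc N * w) = norm q * norm (q ^ N * w)"
      by (simp add: norm_mult norm_power)
    also have "\<dots> < 1"
      using step.IH q mult_left_le_one_le[of "norm (q ^ N * w)" "norm q"] by simp
    finally have 1: "norm (q ^ Suc N * w) < 1" .
    have "lambert_gen q (q ^ N * w) = q ^ N * w / (1 - q ^ N * w) + lambert_gen q (q ^ Suc N * w)"
      using lambert_gen_functional_equation[OF q, of "q ^ N * w"] step.IH by (simp add: mult.assoc)
    with 1 step.IH show ?case
      by (simp add: S_def add.assoc)
  qed (use L in auto)
  from this[OF L(2)] show ?thesis
    unfolding lambert_ext_def L_def[symmetric] S_def Let_def by simp
qed

lemma lambert_ext_eq_gen:
  assumes "norm q < 1" "norm w < 1"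
  shows "lambert_ext q w = lambert_gen q w"
  using lambert_ext_eq[of q 0 w] assms by simp

lemma lambert_ext_functional_equation:
  assumes "norm q < 1"
  shows "lambert_ext q w = w / (1 - w) + lambert_ext q (q * w)"
proof -
  obtain M where M: "norm (q ^ M * (q * w)) < 1"
    using ex_power_times_small[OF assms] by blast
  have "lambert_ext q w =
          (\<Sum>m<Suc M. q ^ m * w / (1 - q ^ m * w)) + lambert_gen q (q ^ Suc M * w)"
    using M by (intro lambert_ext_eq assms) (simp add: mult_ac)
  also have "\<dots> = w / (1 - w) + ((\<Sum>m<M. q ^ m * (q * w) / (1 - q ^ m * (q * w))) +
                   lambert_gen q (q ^ M * (q * w)))"
    by (subst sum.lessThan_Suc_shift) (simp add: mult_ac)
  also have "\<dots> = w / (1 - w) + lambert_ext q (q * w)"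
    using M by (subst lambert_ext_eq[OF assms]) auto
  finally show ?thesis .
qed

lemma lambert_ext_differentiable:
  assumes q: "norm q < 1" and w: "\<And>m. q ^ m * w \<noteq> 1"
  shows "lambert_ext q field_differentiable (at w)"
proof -
  obtain M where M: "norm (q ^ M * w) < 1"
    using ex_power_times_small[OF q] by blast
  define U where "U = {v. norm (q ^ M * v) < 1}"
  have U: "open U" "w \<in> U"
    unfolding U_def using M by (auto intro!: open_Collect_less continuous_intros)
  have gen: "(lambert_gen q \<circ> (\<lambda>v. q ^ M * v)) field_differentiable (at w)"
    using M lambert_gen_holomorphic[OF q]
    by (intro field_differentiable_compose derivative_intros)
       (auto simp: holomorphic_on_imp_differentiable_at)
  have "(\<lambda>v. (\<Sum>m<M. q ^ m * v / (1 - q ^ m * v)) + lambert_gen q (q ^ M * v))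
          field_differentiable (at w)"
  proof (intro field_differentiable_add)
    show "(\<lambda>v. \<Sum>m<M. q ^ m * v / (1 - q ^ m * v)) field_differentiable (at w)"
      using w by (intro field_differentiable_sum field_differentiable_divide derivative_intros) auto
  qed (use gen in \<open>simp add: o_def\<close>)
  moreover have "(\<Sum>m<M. q ^ m * v / (1 - q ^ m * v)) + lambert_gen q (q ^ M * v) = lambert_ext q v"
    if "v \<in> U" for v
    using that by (subst lambert_ext_eq[OF q, of M]) (auto simp: U_def)
  ultimately show ?thesis
    using U unfolding field_differentiable_def
    by (meson has_field_derivative_transform_within_open)
qed

section \<open>Period lattices and Liouville's theorem\<close>

definition period_lattice :: "complex \<Rightarrow> complex set" where
  "period_lattice \<tau> = {of_int m * \<tau> + of_int n | m n. True}"

lemma zero_in_period_lattice: "0 \<in> period_lattice \<tau>"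
  unfolding period_lattice_def by (auto intro!: exI[of _ 0])

lemma period_lattice_add:
  assumes "x \<in> period_lattice \<tau>" "y \<in> period_lattice \<tau>"
  shows "x + y \<in> period_lattice \<tau>"
proof -
  obtain m n m' n' where "x = of_int m * \<tau> + of_int n" "y = of_int m' * \<tau> + of_int n'"
    using assms unfolding period_lattice_def by auto
  hence "x + y = of_int (m + m') * \<tau> + of_int (n + n')"
    by (simp add: algebra_simps)
  thus ?thesis unfolding period_lattice_def by blast
qed

lemma period_lattice_uminus:
  assumes "x \<in> period_lattice \<tau>"
  shows "- x \<in> period_lattice \<tau>"
proof -
  obtain m n where "x = of_int m * \<tau> + of_int n"
    using assms unfolding period_lattice_def by auto
  hence "- x = of_int (- m) * \<tau> + of_int (- n)"
    by (simp add: algebra_simps)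
  thus ?thesis unfolding period_lattice_def by blast
qed

lemma period_lattice_add_iff:
  assumes "x \<in> period_lattice \<tau>"
  shows "z + x \<in> period_lattice \<tau> \<longleftrightarrow> z \<in> period_lattice \<tau>"
  using period_lattice_add[OF _ assms, of z]
    period_lattice_add[OF _ period_lattice_uminus[OF assms], of "z + x"] by auto

lemma period_lattice_near_0:
  assumes "\<tau> \<in> upper_half_plane" "z \<in> period_lattice \<tau>" "norm z < min 1 (Im \<tau>)"
  shows "z = 0"
proof -
  obtain m n where z: "z = of_int m * \<tau> + of_int n"
    using assms unfolding period_lattice_def by auto
  have "m = 0"
  proof (rule ccontr)
    assume "m \<noteq> 0"
    hence "1 * Im \<tau> \<le> \<bar>of_int m\<bar> * Im \<tau>"
      using assms(1) by (intro mult_right_mono) (auto simp: upper_half_plane_def)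
    also have "\<dots> = \<bar>Im z\<bar>"
      using assms(1) by (simp add: z abs_mult upper_half_plane_def)
    also have "\<dots> \<le> norm z"
      by (rule abs_Im_le_cmod)
    finally show False
      using assms(3) by simp
  qed
  hence "norm z = \<bar>of_int n\<bar>"
    by (simp add: z)
  with assms(3) have "n = 0" by linarith
  with \<open>m = 0\<close> z show ?thesis by simp
qed

lemma eventually_not_in_period_lattice:
  assumes "\<tau> \<in> upper_half_plane"
  shows "eventually (\<lambda>z. z \<notin> period_lattice \<tau>) (at 0)"
proof -
  have "min 1 (Im \<tau>) > 0"
    using assms by (simp add: upper_half_plane_def)
  hence "eventually (\<lambda>z. z \<in> ball 0 (min 1 (Im \<tau>)) - {0}) (at 0)"
    by (intro eventually_at_in_open) auto
  thus ?thesis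
    by eventually_elim (use period_lattice_near_0[OF assms] in auto)
qed

lemma closed_period_lattice:
  assumes "\<tau> \<in> upper_half_plane"
  shows "closed (period_lattice \<tau>)"
proof (rule discrete_imp_closed)
  show "0 < min 1 (Im \<tau>)"
    using assms by (simp add: upper_half_plane_def)
  show "\<forall>x\<in>period_lattice \<tau>. \<forall>y\<in>period_lattice \<tau>. dist y x < min 1 (Im \<tau>) \<longrightarrow> y = x"
  proof (intro ballI impI)
    fix x y assume "x \<in> period_lattice \<tau>" "y \<in> period_lattice \<tau>" "dist y x < min 1 (Im \<tau>)"
    hence "y + - x = 0"
      by (intro period_lattice_near_0[OF assms] period_lattice_add period_lattice_uminus)
         (auto simp: dist_norm)
    thus "y = x" by simp
  qed
qed

lemma ex_period_translate_bounded:
  assumes "\<tau> \<in> upper_half_plane"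
  obtains \<omega> where "\<omega> \<in> period_lattice \<tau>" "norm (z - \<omega>) \<le> norm \<tau> + 1"
proof
  define x y where "x = Im z / Im \<tau>" and "y = Re z - x * Re \<tau>"
  have z: "z = of_real x * \<tau> + of_real y"
    using assms by (simp add: x_def y_def complex_eq_iff upper_half_plane_def)
  define \<omega> where "\<omega> = of_int \<lfloor>x\<rfloor> * \<tau> + of_int \<lfloor>y\<rfloor>"
  show "\<omega> \<in> period_lattice \<tau>"
    unfolding \<omega>_def period_lattice_def by blast
  have "z - \<omega> = of_real (frac x) * \<tau> + of_real (frac y)"
    by (simp add: z \<omega>_def frac_def algebra_simps)
  also have "norm \<dots> \<le> norm (of_real (frac x) * \<tau>) + norm (of_real (frac y) :: complex)"
    by (rule norm_triangle_ineq)
  also have "\<dots> \<le> 1 * norm \<tau> + 1"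
    using frac_ge_0[of x] frac_lt_1[of x] frac_ge_0[of y] frac_lt_1[of y]
    by (intro add_mono) (auto simp: norm_mult intro!: mult_left_le_one_le)
  finally show "norm (z - \<omega>) \<le> norm \<tau> + 1" by simp
qed

text \<open>
  The function \<open>h\<close> removes the singularity of \<open>f\<close> at \<open>0\<close>, and by periodicity at every other lattice point.
  The resulting entire function takes all its values on a compact set, because translation by periods moves
  any point into a fixed disc.
\<close>
lemma elliptic_holomorphic_constant:
  assumes \<tau>: "\<tau> \<in> upper_half_plane"
    and diff: "\<And>z. z \<notin> period_lattice \<tau> \<Longrightarrow> f field_differentiable (at z)"
    and period: "\<And>z \<omega>. z \<notin> period_lattice \<tau> \<Longrightarrow> \<omega> \<in> period_lattice \<tau> \<Longrightarrow> f (z + \<omega>) = f z"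
    and h: "open U" "0 \<in> U" "h holomorphic_on U" "\<And>z. z \<in> U - {0} \<Longrightarrow> f z = h z"
  obtains C where "\<And>z. z \<notin> period_lattice \<tau> \<Longrightarrow> f z = C"
proof -
  obtain r where r: "r > 0" "ball 0 r \<subseteq> U"
    using h(1,2) open_contains_ball by blast
  define e where "e = min r (min 1 (Im \<tau>))"
  have e: "e > 0" "e \<le> r" "e \<le> min 1 (Im \<tau>)"
    using r \<tau> by (auto simp: e_def upper_half_plane_def)
  \<comment> \<open>By periodicity the missing values at lattice points are all \<open>h 0\<close>.\<close>
  define F where "F = (\<lambda>z. if z \<in> period_lattice \<tau> then h 0 else f z)"
  have F_period: "F (z + \<omega>) = F z" if "\<omega> \<in> period_lattice \<tau>" for z \<omega>
    using period that by (auto simp: F_def period_lattice_add_iff)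
  have F_near_0: "F z = h z" if "norm z < e" for z
  proof (cases "z = 0")
    case False
    hence "z \<notin> period_lattice \<tau>"
      using period_lattice_near_0[OF \<tau>, of z] that e by auto
    moreover have "z \<in> U - {0}"
      using that e r False by (auto simp: subset_iff)
    ultimately show ?thesis
      using h(4) by (simp add: F_def)
  qed (auto simp: F_def zero_in_period_lattice)
  have h_diff: "h field_differentiable (at 0)"
    using h holomorphic_on_imp_differentiable_at by blast
  have "F field_differentiable (at z)" for z
  proof (cases "z \<in> period_lattice \<tau>")
    case False
    from diff[OF this] obtain D where "(f has_field_derivative D) (at z)"
      by (auto simp: field_differentiable_def)
    hence "(F has_field_derivative D) (at z)"
      by (rule has_field_derivative_transform_within_open[where S = "- period_lattice \<tau>"])
         (use closed_period_lattice[OF \<tau>] False in \<open>auto simp: F_def\<close>)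
    thus ?thesis
      by (auto simp: field_differentiable_def)
  next
    case True
    obtain D where "(h has_field_derivative D) (at 0)"
      using h_diff by (auto simp: field_differentiable_def)
    hence "((\<lambda>x. h (x - z)) has_field_derivative D) (at z)"
      using DERIV_shift[of h D z "- z"] by simp
    hence "(F has_field_derivative D) (at z)"
    proof (rule has_field_derivative_transform_within_open[where S = "ball z e"])
      fix x assume "x \<in> ball z e"
      hence "h (x - z) = F (x - z)"
        using F_near_0[of "x - z"] by (simp add: dist_norm norm_minus_commute)
      also have "F (x - z) = F x"
        using F_period[OF True, of "x - z"] by simp
      finally show "h (x - z) = F x" .
    qed (use e in auto)
    thus ?thesis
      by (auto simp: field_differentiable_def)
  qed
  hence F_hol: "F holomorphic_on UNIV"
    by (simp add: holomorphic_on_def field_differentiable_at_within)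
  have "compact (F ` cball 0 (norm \<tau> + 1))"
    using F_hol by (intro compact_continuous_image holomorphic_on_imp_continuous_on)
                   (auto elim: holomorphic_on_subset)
  moreover have "range F \<subseteq> F ` cball 0 (norm \<tau> + 1)"
  proof safe
    fix z
    obtain \<omega> where "\<omega> \<in> period_lattice \<tau>" "norm (z - \<omega>) \<le> norm \<tau> + 1"
      using ex_period_translate_bounded[OF \<tau>] by blast
    moreover from this have "F z = F (z - \<omega>)"
      using F_period[of \<omega> "z - \<omega>"] by simp
    ultimately show "F z \<in> F ` cball 0 (norm \<tau> + 1)"
      by auto
  qed
  ultimately have "bounded (range F)"
    using bounded_subset compact_imp_bounded by blast
  with F_hol have "F constant_on UNIV"
    by (rule Liouville_theorem)
  then obtain C where "\<And>z. F z = C"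
    by (auto simp: constant_on_def)
  with that[of C] show ?thesis
    by (metis F_def)
qed

section \<open>The logarithmic derivative of the theta function\<close>

lemma nome_eq_1_iff: "nome z = 1 \<longleftrightarrow> (\<exists>n::int. z = of_int n)"
  unfolding nome_def exp_eq_1 by (auto simp: complex_eq_iff)

lemma nome_of_nat_mult: "nome (of_nat m * \<tau>) = nome \<tau> ^ m"
  by (simp add: nome_def exp_of_nat_mult[symmetric] mult_ac)

lemma nome_powers_ne_1:
  assumes "z \<notin> period_lattice \<tau>"
  shows "nome \<tau> ^ m * nome z \<noteq> 1" "nome \<tau> ^ m * (nome \<tau> / nome z) \<noteq> 1"
proof -
  show "nome \<tau> ^ m * nome z \<noteq> 1"
  proof
    assume "nome \<tau> ^ m * nome z = 1"
    hence "nome (of_nat m * \<tau> + z) = 1"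
      by (simp add: nome_add nome_of_nat_mult)
    then obtain n :: int where "of_nat m * \<tau> + z = of_int n"
      by (auto simp: nome_eq_1_iff)
    hence "z = of_int (- int m) * \<tau> + of_int n"
      by (simp add: algebra_simps)
    thus False
      using assms unfolding period_lattice_def by blast
  qed
  show "nome \<tau> ^ m * (nome \<tau> / nome z) \<noteq> 1"
  proof
    assume "nome \<tau> ^ m * (nome \<tau> / nome z) = 1"
    hence "nome \<tau> ^ Suc m = nome z"
      by (simp add: field_simps)
    also have "nome z = nome (z - of_nat (Suc m) * \<tau>) * nome \<tau> ^ Suc m"
      unfolding nome_of_nat_mult[symmetric] nome_add[symmetric] by simp
    finally have "nome (z - of_nat (Suc m) * \<tau>) = 1"
      by simp
    then obtain n :: int where "z - of_nat (Suc m) * \<tau> = of_int n"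
      by (auto simp: nome_eq_1_iff)
    hence "z = of_int (int (Suc m)) * \<tau> + of_int n"
      by (simp add: algebra_simps)
    thus False
      using assms unfolding period_lattice_def by blast
  qed
qed

text \<open>
  With \<open>w = exp (2\<pi>\<i>z)\<close>, the product formula for Jacobi's odd theta function has the factors
  \<open>1 - q\<^sup>m w\<close> for \<open>m \<ge> 0\<close> and \<open>1 - q\<^sup>m/w\<close> for \<open>m \<ge> 1\<close>, up to \<open>exp (- \<pi>\<i>z)\<close> and a factor independent of \<open>z\<close>.
  The three summands are the logarithmic derivatives of the exponential and of the two families of factors.
\<close>
definition theta_log_deriv :: "complex \<Rightarrow> complex \<Rightarrow> complex" where
  "theta_log_deriv \<tau> z = 2 * of_real pi * \<i> *
     (- (1 / 2) - lambert_ext (nome \<tau>) (nome z) + lambert_ext (nome \<tau>) (nome \<tau> / nome z))"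

lemma theta_log_deriv_differentiable:
  assumes "\<tau> \<in> upper_half_plane" "z \<notin> period_lattice \<tau>"
  shows "theta_log_deriv \<tau> field_differentiable (at z)"
proof -
  have nome: "nome field_differentiable (at z)"
    using has_field_derivative_nome by (auto simp: field_differentiable_def)
  have "(lambert_ext (nome \<tau>) \<circ> nome) field_differentiable (at z)"
    using assms by (intro field_differentiable_compose nome lambert_ext_differentiable
                      norm_nome_less_1 nome_powers_ne_1)
  moreover have "(lambert_ext (nome \<tau>) \<circ> (\<lambda>z. nome \<tau> / nome z)) field_differentiable (at z)"
    using assms by (intro field_differentiable_compose field_differentiable_divide nome
                      lambert_ext_differentiable norm_nome_less_1 nome_powers_ne_1) auto
  ultimately show ?thesis
    unfolding theta_log_deriv_def[abs_def]
    by (intro field_differentiable_mult field_differentiable_add field_differentiable_diff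
          field_differentiable_const) (simp_all add: o_def)
qed

lemma theta_log_deriv_add_1: "theta_log_deriv \<tau> (z + 1) = theta_log_deriv \<tau> z"
proof -
  have "nome 1 = 1"
    using nome_eq_1_iff[of 1] by (metis of_int_1)
  hence "nome (z + 1) = nome z"
    by (simp add: nome_add)
  thus ?thesis
    by (simp add: theta_log_deriv_def)
qed

text \<open>
  Here \<open>w\<close> becomes \<open>qw\<close>.  The functional equation moves the factor \<open>m = 0\<close> from one sum to the other, at the
  cost of \<open>w/(1 - w) + (1/w)/(1 - 1/w) = - 1\<close>.
\<close>
lemma theta_log_deriv_add_tau:
  assumes "\<tau> \<in> upper_half_plane" "z \<notin> period_lattice \<tau>"
  shows "theta_log_deriv \<tau> (z + \<tau>) = theta_log_deriv \<tau> z - 2 * of_real pi * \<i>"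
proof -
  define q w where "q = nome \<tau>" and "w = nome z"
  have q: "norm q < 1"
    using assms norm_nome_less_1 by (simp add: q_def)
  have w: "w \<noteq> 0" "w \<noteq> 1" "q \<noteq> 0"
    using nome_powers_ne_1(1)[OF assms(2), of 0] by (simp_all add: w_def q_def)
  have "lambert_ext q w = w / (1 - w) + lambert_ext q (q * w)"
       "lambert_ext q (1 / w) = (1 / w) / (1 - 1 / w) + lambert_ext q (q / w)"
    using lambert_ext_functional_equation[OF q, of w]
          lambert_ext_functional_equation[OF q, of "1 / w"] by auto
  moreover have "(1 / w) / (1 - 1 / w) = - 1 - w / (1 - w)"
    using w by (simp add: field_simps)
  ultimately have "- (1 / 2) - lambert_ext q (q * w) + lambert_ext q (1 / w) =
                   - (1 / 2) - lambert_ext q w + lambert_ext q (q / w) - 1"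
    by simp
  moreover have "nome (z + \<tau>) = q * w" "q / (q * w) = 1 / w"
    using w by (simp_all add: nome_add q_def w_def)
  hence "theta_log_deriv \<tau> (z + \<tau>) =
           2 * of_real pi * \<i> * (- (1 / 2) - lambert_ext q (q * w) + lambert_ext q (1 / w))"
    by (simp only: theta_log_deriv_def q_def[symmetric])
  moreover have "theta_log_deriv \<tau> z =
           2 * of_real pi * \<i> * (- (1 / 2) - lambert_ext q w + lambert_ext q (q / w))"
    by (simp only: theta_log_deriv_def q_def w_def)
  ultimately show ?thesis
    by (simp only: right_diff_distrib) simp
qed

lemma theta_log_deriv_add_period:
  assumes \<tau>: "\<tau> \<in> upper_half_plane" and z: "z \<notin> period_lattice \<tau>"
  shows "theta_log_deriv \<tau> (z + (of_int m * \<tau> + of_int n)) =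
           theta_log_deriv \<tau> z - 2 * of_real pi * \<i> * of_int m"
proof -
  have lat: "of_int i * \<tau> + of_int j \<in> period_lattice \<tau>" for i j
    unfolding period_lattice_def by blast
  have lat': "of_int i * \<tau> \<in> period_lattice \<tau>" for i
    using lat[of i 0] by simp
  have 1: "theta_log_deriv \<tau> (x + of_int n) = theta_log_deriv \<tau> x" for x n
  proof (induction n rule: int_induct[where k = 0])
    case (step1 i)
    thus ?case using theta_log_deriv_add_1[of \<tau> "x + of_int i"] by (simp add: add.assoc)
  next
    case (step2 i)
    thus ?case using theta_log_deriv_add_1[of \<tau> "x + of_int (i - 1)"] by (simp add: algebra_simps)
  qed auto
  have 2: "theta_log_deriv \<tau> (z + of_int m * \<tau>) = theta_log_deriv \<tau> z - 2 * of_real pi * \<i> * of_int m"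
  proof (induction m rule: int_induct[where k = 0])
    case (step1 i)
    have "z + of_int i * \<tau> \<notin> period_lattice \<tau>"
      using z lat' by (simp add: period_lattice_add_iff)
    note shift = theta_log_deriv_add_tau[OF \<tau> this]
    have "z + of_int (i + 1) * \<tau> = (z + of_int i * \<tau>) + \<tau>"
      by (simp add: algebra_simps)
    thus ?case
      by (simp only: shift step1.IH) (simp add: algebra_simps)
  next
    case (step2 i)
    have "z + of_int (i - 1) * \<tau> \<notin> period_lattice \<tau>"
      using z lat' by (simp only: period_lattice_add_iff) simp
    note shift = theta_log_deriv_add_tau[OF \<tau> this]
    have eq: "(z + of_int (i - 1) * \<tau>) + \<tau> = z + of_int i * \<tau>"
      by (simp add: algebra_simps)
    have "theta_log_deriv \<tau> (z + of_int (i - 1) * \<tau>) =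
                       theta_log_deriv \<tau> (z + of_int i * \<tau>) + 2 * of_real pi * \<i>"
      using shift[unfolded eq] by simp
    thus ?case
      by (simp only: step2.IH) (simp add: algebra_simps)
  qed auto
  show ?thesis
    using 1[of "z + of_int m * \<tau>" n] 2 by (simp add: add.assoc)
qed

section \<open>Eisenstein series as Taylor coefficients\<close>

text \<open>
  For \<open>s = k - 1\<close> this is the part of \<open>G\<^sub>k\<close> without constant term.
\<close>
definition sigma_series :: "complex \<Rightarrow> nat \<Rightarrow> complex" where
  "sigma_series q s = (\<Sum>n. of_nat (divisor_sigma s (Suc n)) * q ^ Suc n)"

lemma has_sum_from_1_iff:
  "(g has_sum S) {1..} \<longleftrightarrow> ((\<lambda>n. g (Suc n)) has_sum S) UNIV"
proof -
  have "(g has_sum S) (Suc ` UNIV) \<longleftrightarrow> (g \<circ> Suc has_sum S) UNIV"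
    by (rule has_sum_reindex) auto
  moreover have "Suc ` UNIV = {1..}"
    by (auto simp: image_iff Suc_le_eq gr0_conv_Suc)
  ultimately show ?thesis
    by (simp add: o_def)
qed

lemma summable_on_double_lambert:
  fixes q :: complex
  assumes q: "norm q < 1"
  shows "(\<lambda>(d, m). of_nat d ^ s * (q ^ d) ^ m) summable_on {1..} \<times> {1..}"
proof (rule abs_summable_summable)
  define \<rho> where "\<rho> = norm q"
  have \<rho>: "0 \<le> \<rho>" "\<rho> < 1"
    using q by (auto simp: \<rho>_def)
  have le: "\<rho> ^ d \<le> \<rho>" if "d \<ge> 1" for d
    using power_decreasing[of 1 d \<rho>] that \<rho> by simp
  have "(\<lambda>(d, m). real d ^ s * (\<rho> ^ d) ^ m) summable_on {1..} \<times> {1..}"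
  proof (rule summable_on_SigmaI)
    fix d :: nat assume "d \<in> {1..}"
    hence "((\<lambda>m. (\<rho> ^ d) ^ m) has_sum (\<rho> ^ d / (1 - \<rho> ^ d))) {1..}"
      using le[of d] \<rho> by (intro has_sum_geometric_from_1) simp
    from has_sum_cmult_right[OF this, of "real d ^ s"]
    show "((\<lambda>m. case (d, m) of (d, m) \<Rightarrow> real d ^ s * (\<rho> ^ d) ^ m) has_sum
             (real d ^ s * (\<rho> ^ d / (1 - \<rho> ^ d)))) {1..}"
      by simp
  next
    have "summable (\<lambda>n. norm (of_nat n ^ s * (of_real \<rho> :: complex) ^ n))"
      by (intro powser_insidea[of _ "of_real ((1 + \<rho>) / 2)"] summable_power_times_geometric)
         (use \<rho> in \<open>simp_all only: norm_of_real, simp_all\<close>)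
    hence "summable (\<lambda>n. real n ^ s * \<rho> ^ n)"
      using \<rho> by (simp add: norm_mult norm_power)
    hence "summable (\<lambda>n. real n ^ s * \<rho> ^ n * (1 / (1 - \<rho>)))"
      by (rule summable_mult2)
    hence "(\<lambda>n. real n ^ s * \<rho> ^ n * (1 / (1 - \<rho>))) summable_on UNIV"
      using \<rho> by (subst summable_on_UNIV_nonneg_real_iff) auto
    hence "(\<lambda>n. real n ^ s * \<rho> ^ n * (1 / (1 - \<rho>))) summable_on {1..}"
      by (rule summable_on_subset) auto
    thus "(\<lambda>d. real d ^ s * (\<rho> ^ d / (1 - \<rho> ^ d))) summable_on {1..}"
    proof (rule summable_on_comparison_test)
      fix d :: nat assume d: "d \<in> {1..}"
      have "\<rho> ^ d / (1 - \<rho> ^ d) \<le> \<rho> ^ d / (1 - \<rho>)"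
        using le[of d] d \<rho> by (intro divide_left_mono) auto
      from mult_left_mono[OF this, of "real d ^ s"]
      show "real d ^ s * (\<rho> ^ d / (1 - \<rho> ^ d)) \<le> real d ^ s * \<rho> ^ d * (1 / (1 - \<rho>))"
        by simp
      show "0 \<le> real d ^ s * (\<rho> ^ d / (1 - \<rho> ^ d))"
        using le[of d] d \<rho> by simp
    qed
  qed (use \<rho> in auto)
  thus "(\<lambda>x. norm (case x of (d, m) \<Rightarrow> of_nat d ^ s * (q ^ d) ^ m)) summable_on {1..} \<times> {1..}"
    by (simp add: case_prod_unfold norm_mult norm_power \<rho>_def)
qed

text \<open>
  Both sides are the sum of \<open>d\<^sup>s q\<^sup>d\<^sup>m\<close> over \<open>d, m \<ge> 1\<close>: summing over \<open>m\<close> first gives geometric series, and grouping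
  by \<open>N = dm\<close> gives divisor sums.
\<close>
lemma lambert_series_eq_sigma_series:
  assumes q: "norm q < 1"
  shows "((\<lambda>n. of_nat (Suc n) ^ s * (q ^ Suc n / (1 - q ^ Suc n))) has_sum sigma_series q s) UNIV"
proof -
  define f :: "nat \<times> nat \<Rightarrow> complex" where "f = (\<lambda>(d, m). of_nat d ^ s * (q ^ d) ^ m)"
  define S where "S = infsum f ({1..} \<times> {1..})"
  have S: "(f has_sum S) ({1..} \<times> {1..})"
    using summable_on_double_lambert[OF q, of s] unfolding S_def f_def by (rule has_sum_infsum)
  have "((\<lambda>d. of_nat d ^ s * (q ^ d / (1 - q ^ d))) has_sum S) {1..}"
  proof (rule has_sum_SigmaD[OF S])
    fix d :: nat assume "d \<in> {1..}"
    then obtain d' where d': "d = Suc d'" by (cases d) auto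
    have "norm (q ^ d) < 1"
      unfolding d' using norm_power_Suc_le[OF q, of d'] q by simp
    from has_sum_cmult_right[OF has_sum_geometric_from_1[OF this], of "of_nat d ^ s"]
    show "((\<lambda>m. f (d, m)) has_sum of_nat d ^ s * (q ^ d / (1 - q ^ d))) {1..}"
      by (simp add: f_def)
  qed
  hence lhs: "((\<lambda>n. of_nat (Suc n) ^ s * (q ^ Suc n / (1 - q ^ Suc n))) has_sum S) UNIV"
    by (subst (asm) has_sum_from_1_iff)

  have "((\<lambda>(N, d). of_nat d ^ s * q ^ N) has_sum S) (Sigma {1..} (\<lambda>N. {d. d dvd N})) \<longleftrightarrow>
        (f has_sum S) ({1..} \<times> {1..})"
    by (rule has_sum_reindex_bij_witness[where i = "\<lambda>(d, m). (d * m, d)" and j = "\<lambda>(N, d). (d, N div d)"])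
       (auto simp: f_def power_mult Suc_le_eq dvd_div_eq_0_iff intro!: Nat.gr0I)
  with S have "((\<lambda>(N, d). of_nat d ^ s * q ^ N) has_sum S) (Sigma {1..} (\<lambda>N. {d. d dvd N}))"
    by simp
  hence "((\<lambda>N. of_nat (divisor_sigma s N) * q ^ N) has_sum S) {1..}"
    by (rule has_sum_SigmaD)
       (auto simp: divisor_sigma_def sum_distrib_right intro!: has_sum_finiteI)
  hence "((\<lambda>n. of_nat (divisor_sigma s (Suc n)) * q ^ Suc n) has_sum S) UNIV"
    by (subst (asm) has_sum_from_1_iff)
  hence "S = sigma_series q s"
    unfolding sigma_series_def by (intro sums_unique has_sum_imp_sums)
  with lhs show ?thesis by simp
qed

lemma exp_has_sum: 
  fixes x :: "'a :: {real_normed_field, banach}"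
  shows "((\<lambda>s. x ^ s / fact s) has_sum exp x) UNIV"
proof (rule norm_summable_imp_has_sum)
  show "(\<lambda>s. x ^ s / fact s) sums exp x"
    using exp_converges[of x] by (simp add: scaleR_conv_of_real field_simps)
  show "summable (\<lambda>s. norm (x ^ s / fact s))"
    using summable_norm_exp[of x] by (simp add: scaleR_conv_of_real field_simps norm_divide norm_mult)
qed

text \<open>
  Expand each \<open>exp (nx)\<close> and exchange the two summations.  The double series converges absolutely because
  replacing \<open>x\<close> by \<open>norm x\<close> turns it into a series dominated by a geometric one of ratio
  \<open>norm q * exp (norm x)\<close>.
\<close>
lemma lambert_gen_exp_sums:
  assumes q: "norm q < 1" and small: "norm q * exp (norm x) < 1"
  shows "(\<lambda>s. sigma_series q s * x ^ s / fact s) sums lambert_gen q (q * exp x)"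
proof -
  define t where "t = (\<lambda>n. q ^ Suc n / (1 - q ^ Suc n))"
  define f :: "nat \<times> nat \<Rightarrow> complex" where
    "f = (\<lambda>(n, s). t n * ((of_nat (Suc n) * x) ^ s / fact s))"
  have summ: "summable (\<lambda>n. norm (t n) * exp (real (Suc n) * norm x))"
  proof (rule summable_comparison_test', rule summable_mult2)
    show "summable (\<lambda>n. (norm q * exp (norm x)) ^ Suc n)"
      using small by (subst summable_Suc_iff) (auto intro: summable_geometric)
    fix n :: nat
    have "norm (t n) \<le> norm q ^ Suc n * (1 / (1 - norm q))"
      using mult_left_mono[OF norm_inverse_one_minus_power_le[OF q, of n], of "norm q ^ Suc n"]
      by (simp add: t_def norm_divide norm_mult norm_power)
    hence "norm (t n) * exp (real (Suc n) * norm x) \<le>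
             norm q ^ Suc n * (1 / (1 - norm q)) * exp (real (Suc n) * norm x)"
      by (rule mult_right_mono) simp
    thus "norm (norm (t n) * exp (real (Suc n) * norm x)) \<le>
                    (norm q * exp (norm x)) ^ Suc n * (1 / (1 - norm q))"
      unfolding exp_of_nat_mult
      by (simp add: power_mult_distrib mult_ac del: of_nat_Suc power_Suc)
  qed
  have "(\<lambda>(n, s). norm (t n) * ((real (Suc n) * norm x) ^ s / fact s)) summable_on UNIV \<times> UNIV"
  proof (rule summable_on_SigmaI)
    show "((\<lambda>s. case (n, s) of (n, s) \<Rightarrow> norm (t n) * ((real (Suc n) * norm x) ^ s / fact s)) has_sum
             norm (t n) * exp (real (Suc n) * norm x)) UNIV" for n
      using has_sum_cmult_right[OF exp_has_sum[of "real (Suc n) * norm x"], of "norm (t n)"] by simp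
    show "(\<lambda>n. norm (t n) * exp (real (Suc n) * norm x)) summable_on UNIV"
      using summ by (subst summable_on_UNIV_nonneg_real_iff) auto
  qed auto
  hence "(\<lambda>z. norm (f z)) summable_on UNIV \<times> UNIV"
    by (simp add: f_def case_prod_unfold norm_mult norm_power norm_divide del: of_nat_Suc)
  hence f: "f summable_on UNIV \<times> UNIV"
    by (rule abs_summable_summable)
  have inner: "((\<lambda>s. f (n, s)) has_sum t n * exp (of_nat (Suc n) * x)) UNIV" for n
    using has_sum_cmult_right[OF exp_has_sum[of "of_nat (Suc n) * x"], of "t n"] by (simp add: f_def)
  have total: "((\<lambda>n. t n * exp (of_nat (Suc n) * x)) has_sum lambert_gen q (q * exp x)) UNIV"
  proof (rule norm_summable_imp_has_sum)
    have "norm (exp (of_nat (Suc n) * x)) \<le> exp (real (Suc n) * norm x)" for n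
    proof -
      have "Re (of_nat (Suc n) * x) \<le> norm (of_nat (Suc n) * x)"
        by (rule complex_Re_le_cmod)
      also have "\<dots> = real (Suc n) * norm x"
        by (simp add: norm_mult del: of_nat_Suc)
      finally show ?thesis
        by (simp only: norm_exp_eq_Re exp_le_cancel_iff)
    qed
    thus "summable (\<lambda>n. norm (t n * exp (of_nat (Suc n) * x)))"
      by (intro summable_comparison_test'[OF summ])
         (simp add: norm_mult mult_left_mono del: of_nat_Suc)
    have "norm (exp x) \<le> exp (norm x)"
      by (rule norm_exp)
    hence "norm (q * exp x) < 1"
      using small mult_left_mono[of "norm (exp x)" "exp (norm x)" "norm q"]
      by (simp add: norm_mult del: norm_exp_eq_Re)
    from lambert_gen_sums[OF q this]
    show "(\<lambda>n. t n * exp (of_nat (Suc n) * x)) sums lambert_gen q (q * exp x)"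
      unfolding t_def by (simp only: power_mult_distrib exp_of_nat_mult times_divide_eq_left)
  qed
  have "(f has_sum lambert_gen q (q * exp x)) (UNIV \<times> UNIV)"
    by (rule has_sum_SigmaI[OF inner total f])
  hence "((\<lambda>(s, n). f (n, s)) has_sum lambert_gen q (q * exp x)) (UNIV \<times> UNIV)"
    by (subst (asm) has_sum_swap) (simp add: case_prod_unfold)
  hence "((\<lambda>s. sigma_series q s * x ^ s / fact s) has_sum lambert_gen q (q * exp x)) UNIV"
  proof (rule has_sum_SigmaD)
    fix s :: nat
    have "((\<lambda>n. of_nat (Suc n) ^ s * (q ^ Suc n / (1 - q ^ Suc n)) * (x ^ s / fact s)) has_sum
             sigma_series q s * (x ^ s / fact s)) UNIV"
      by (intro has_sum_cmult_left lambert_series_eq_sigma_series q)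
    moreover have "(\<lambda>n. of_nat (Suc n) ^ s * (q ^ Suc n / (1 - q ^ Suc n)) * (x ^ s / fact s)) =
                   (\<lambda>n. case (s, n) of (s, n) \<Rightarrow> f (n, s))"
      by (simp add: f_def t_def fun_eq_iff power_mult_distrib mult_ac del: of_nat_Suc power_Suc)
    ultimately show "((\<lambda>n. case (s, n) of (s, n) \<Rightarrow> f (n, s)) has_sum
             sigma_series q s * x ^ s / fact s) UNIV"
      by (simp only: times_divide_eq_right)
  qed
  thus ?thesis
    by (rule has_sum_imp_sums)
qed

lemma lambert_gen_exp_has_fps_expansion:
  assumes q: "norm q < 1"
  shows "(\<lambda>z. lambert_gen q (q * exp (a * z))) has_fps_expansion
           Abs_fps (\<lambda>s. sigma_series q s * a ^ s / fact s)"
proof (rule has_fps_expansionI)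
  have "((\<lambda>z. norm q * exp (norm (a * z))) \<longlongrightarrow> norm q * exp (norm (a * 0))) (nhds 0)"
    by (intro tendsto_intros filterlim_ident)
  hence "eventually (\<lambda>z. norm q * exp (norm (a * z)) < 1) (nhds 0)"
    using q by (intro order_tendstoD(2)) auto
  thus "eventually (\<lambda>z. (\<lambda>s. fps_nth (Abs_fps (\<lambda>s. sigma_series q s * a ^ s / fact s)) s * z ^ s) sums
                          lambert_gen q (q * exp (a * z))) (nhds 0)"
  proof eventually_elim
    case (elim z)
    from lambert_gen_exp_sums[OF q elim] show ?case
      by (simp add: power_mult_distrib mult_ac)
  qed
qed

text \<open>
  The power series of \<open>ax / (exp (ax) - 1)\<close>.
\<close>
definition bernoulli_fps :: "complex \<Rightarrow> complex fps" where
  "bernoulli_fps a = Abs_fps (\<lambda>n. a ^ n * of_real (bernoulli_number n) / fact n)"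

text \<open>
  The coefficientwise image of the real identity that defines the Bernoulli numbers, rescaled by powers
  of \<open>a\<close>.
\<close>
lemma bernoulli_fps_times_exp:
  "bernoulli_fps a * (fps_exp a - 1) = fps_const a * fps_X"
proof (rule fps_ext)
  fix n
  define B where "B = (fps_X / (fps_exp 1 - 1) :: real fps)"
  have ne: "fps_exp 1 - 1 \<noteq> (0 :: real fps)"
  proof
    assume "fps_exp 1 - 1 = (0 :: real fps)"
    hence "fps_nth (fps_exp 1 - 1) 1 = fps_nth (0 :: real fps) 1" by (rule arg_cong)
    thus False by simp
  qed
  have "subdegree (fps_exp 1 - 1 :: real fps) = 1"
    by (rule subdegreeI) auto
  hence "(fps_exp 1 - 1 :: real fps) dvd fps_X"
    using ne by (subst fps_dvd_iff) auto
  hence "B * (fps_exp 1 - 1) = fps_X"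
    by (simp add: B_def)
  hence "(\<Sum>i=0..n. fps_nth B i * fps_nth (fps_exp 1 - 1) (n - i)) = fps_nth (fps_X :: real fps) n"
    by (metis fps_mult_nth)
  hence *: "(\<Sum>i=0..n. of_real (fps_nth B i) * (of_real (fps_nth (fps_exp 1 - 1) (n - i)) :: complex)) =
           of_real (fps_nth fps_X n)"
    by (metis (no_types, lifting) of_real_mult of_real_sum sum.cong)
  have "fps_nth (bernoulli_fps a * (fps_exp a - 1)) n =
          (\<Sum>i=0..n. (a ^ i * of_real (fps_nth B i)) *
             (a ^ (n - i) * of_real (fps_nth (fps_exp 1 - 1) (n - i))))"
    unfolding fps_mult_nth
    by (intro sum.cong) (auto simp: bernoulli_fps_def bernoulli_number_def B_def of_real_divide)
  also have "\<dots> = (\<Sum>i=0..n. a ^ n * (of_real (fps_nth B i) * of_real (fps_nth (fps_exp 1 - 1) (n - i))))"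
    by (intro sum.cong) (auto simp: power_add[symmetric] mult_ac)
  also have "\<dots> = a ^ n * of_real (fps_nth fps_X n)"
    by (simp only: sum_distrib_left[symmetric] *)
  also have "\<dots> = fps_nth (fps_const a * fps_X) n"
    by (simp add: fps_X_def)
  finally show "fps_nth (bernoulli_fps a * (fps_exp a - 1)) n = fps_nth (fps_const a * fps_X) n" .
qed

lemma bernoulli_number_0: "bernoulli_number 0 = 1"
proof -
  have "fps_nth (bernoulli_fps 1 * (fps_exp 1 - 1)) 1 = 1"
    by (simp add: bernoulli_fps_times_exp)
  thus ?thesis
    by (simp add: fps_mult_nth bernoulli_fps_def)
qed

lemma exp_minus_1_inverse_has_fps_expansion:
  assumes "a \<noteq> 0"
  shows "(\<lambda>z. if z = 0 then fps_nth (bernoulli_fps a) 1 else a / (exp (a * z) - 1) - 1 / z)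
           has_fps_expansion fps_shift 1 (bernoulli_fps a - 1)"
proof -
  have G: "fps_nth (fps_exp a - 1) 0 = 0" "fps_nth (fps_exp a - 1) (Suc 0) = a"
    by simp_all
  hence ne: "fps_exp a - 1 \<noteq> 0"
    using assms by (metis fps_zero_nth)
  have sub: "subdegree (fps_exp a - 1) = 1"
    using assms G by (intro subdegreeI) auto
  have "(\<lambda>z. if z = 0 then 1 else (a * z) / (exp (a * z) - 1)) has_fps_expansion
          (fps_const a * fps_X) / (fps_exp a - 1)"
  proof (rule has_fps_expansion_divide)
    show "subdegree (fps_exp a - 1) \<le> subdegree (fps_const a * fps_X)"
      unfolding sub using assms by simp
    show "1 = fps_nth (fps_const a * fps_X) (subdegree (fps_exp a - 1)) /
              fps_nth (fps_exp a - 1) (subdegree (fps_exp a - 1))"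
      unfolding sub using assms by simp
  qed (intro fps_expansion_intros ne)+
  also have "(fps_const a * fps_X) / (fps_exp a - 1) = bernoulli_fps a"
    using ne by (simp flip: bernoulli_fps_times_exp)
  finally have "(\<lambda>z. (if z = 0 then 1 else (a * z) / (exp (a * z) - 1)) - 1)
                  has_fps_expansion (bernoulli_fps a - 1)"
    by (intro fps_expansion_intros)
  \<comment> \<open>The zero series has subdegree \<open>0\<close>, so it has to be excluded before the constant term is used.\<close>
  moreover have "bernoulli_fps a - 1 \<noteq> 0"
  proof
    assume "bernoulli_fps a - 1 = 0"
    hence "fps_exp a - 1 = fps_const a * fps_X"
      using bernoulli_fps_times_exp[of a] by simp
    hence "fps_nth (fps_exp a - 1) 2 = fps_nth (fps_const a * fps_X) 2"
      by (rule arg_cong)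
    thus False
      using assms by (simp add: fps_X_def)
  qed
  hence "1 \<le> subdegree (bernoulli_fps a - 1)"
    using bernoulli_number_0 by (intro subdegree_geI) (auto simp: bernoulli_fps_def)
  moreover have "fps_nth (bernoulli_fps a) 1 = fps_nth (bernoulli_fps a - 1) 1"
    by simp
  ultimately have "(\<lambda>z. if z = 0 then fps_nth (bernoulli_fps a) 1 else
                      ((if z = 0 then 1 else (a * z) / (exp (a * z) - 1)) - 1) / z ^ 1)
                   has_fps_expansion fps_shift 1 (bernoulli_fps a - 1)"
    by (rule has_fps_expansion_shift)
  also have "(\<lambda>z. if z = 0 then fps_nth (bernoulli_fps a) 1 else
                      ((if z = 0 then 1 else (a * z) / (exp (a * z) - 1)) - 1) / z ^ 1) =
             (\<lambda>z. if z = 0 then fps_nth (bernoulli_fps a) 1 else a / (exp (a * z) - 1) - 1 / z)"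
    by (auto simp: fun_eq_iff diff_divide_distrib)
  finally show ?thesis .
qed

text \<open>
  The Taylor series at \<open>0\<close> of \<open>theta_log_deriv \<tau> z - 1/z\<close>.  The Bernoulli part comes from the summand
  \<open>a / (exp (az) - 1)\<close> with \<open>a = 2\<pi>\<i>\<close>, and the divisor sums come from the remaining Lambert series.
\<close>
definition theta_reg_fps :: "complex \<Rightarrow> complex fps" where
  "theta_reg_fps \<tau> = (let a = 2 * of_real pi * \<i>; L = sigma_series (nome \<tau>) in
     fps_const (a / 2) + fps_shift 1 (bernoulli_fps a - 1) +
     fps_const a * (Abs_fps (\<lambda>s. L s * (- a) ^ s / fact s) - Abs_fps (\<lambda>s. L s * a ^ s / fact s)))"

text \<open>
  In odd degree \<open>s = k - 1\<close> the two Lambert series reinforce each other to \<open>- 2 a\<^sup>k L / s!\<close> with \<open>a = 2\<pi>\<i>\<close>, and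
  \<open>a\<^sup>k B\<^sub>k / k!\<close> is the same multiple \<open>- 2 a\<^sup>k / s!\<close> of \<open>- B\<^sub>k / (2k)\<close>.
\<close>
lemma theta_reg_fps_nth:
  assumes "even k" "k \<ge> 2"
  shows "fps_nth (theta_reg_fps \<tau>) (k - 1) =
           - 2 * (2 * of_real pi * \<i>) ^ k / fact (k - 1) * eisenstein_G k \<tau>"
proof -
  define a where "a = 2 * of_real pi * \<i>"
  define L where "L = sigma_series (nome \<tau>) (k - 1)"
  obtain s where k: "k = Suc s" "odd s"
    using assms by (cases k) auto
  have G: "eisenstein_G k \<tau> = - of_real (bernoulli_number k) / (2 * of_nat k) + L"
    by (simp add: eisenstein_G_def L_def sigma_series_def)
  have "s \<noteq> 0"
    using k by (auto intro: ccontr)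
  hence "fps_nth (theta_reg_fps \<tau>) s = a ^ k * of_real (bernoulli_number k) / fact k +
           a * (L * (- a) ^ s / fact s - L * a ^ s / fact s)"
    unfolding theta_reg_fps_def Let_def a_def[symmetric]
    by (simp add: bernoulli_fps_def L_def k)
  also have "(- a) ^ s = - (a ^ s)"
    using k by simp
  also have "a ^ k * of_real (bernoulli_number k) / fact k + a * (L * - (a ^ s) / fact s - L * a ^ s / fact s) =
               - 2 * a ^ k / fact s * eisenstein_G k \<tau>"
    unfolding G by (simp add: k(1) field_simps del: of_nat_Suc)
  finally show ?thesis
    unfolding a_def k by simp
qed

text \<open>
  Near the origin, one step of the functional equation isolates the pole \<open>w/(1 - w)\<close>; the arguments \<open>qw\<close> and
  \<open>q/w\<close> that remain lie in the unit disc.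
\<close>
lemma theta_log_deriv_has_fps_expansion:
  assumes "\<tau> \<in> upper_half_plane"
  obtains f where "f has_fps_expansion theta_reg_fps \<tau>"
    "eventually (\<lambda>z. f z = theta_log_deriv \<tau> z - 1 / z) (at 0)"
proof -
  define a where "a = 2 * of_real pi * \<i>"
  define q where "q = nome \<tau>"
  have q: "norm q < 1"
    using assms norm_nome_less_1 by (simp add: q_def)
  have a: "a \<noteq> 0"
    by (simp add: a_def)
  define f where "f = (\<lambda>z. a / 2 + (if z = 0 then fps_nth (bernoulli_fps a) 1 else a / (exp (a * z) - 1) - 1 / z) +
       a * (lambert_gen q (q * exp ((- a) * z)) - lambert_gen q (q * exp (a * z))))"
  have "f has_fps_expansion theta_reg_fps \<tau>"
    unfolding f_def theta_reg_fps_def Let_def a_def[symmetric] q_def[symmetric]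
    by (intro has_fps_expansion_add has_fps_expansion_diff has_fps_expansion_cmult_left
          has_fps_expansion_const exp_minus_1_inverse_has_fps_expansion
          lambert_gen_exp_has_fps_expansion a q)
  moreover have "eventually (\<lambda>z. f z = theta_log_deriv \<tau> z - 1 / z) (at 0)"
  proof -
    have "((\<lambda>z. norm (q * exp (c * z))) \<longlongrightarrow> norm (q * exp (c * 0))) (nhds 0)" for c :: complex
      by (intro tendsto_intros filterlim_ident)
    hence "eventually (\<lambda>z. norm (q * exp (c * z)) < 1) (nhds 0)" for c :: complex
      using q by (intro order_tendstoD(2)) auto
    hence "eventually (\<lambda>z. norm (q * exp (c * z)) < 1) (at 0)" for c :: complex
      using eventually_nhds_conv_at by blast
    from this[of a] this[of "- a"]
    have "eventually (\<lambda>z. norm (q * exp (a * z)) < 1 \<and> norm (q * exp (- a * z)) < 1) (at 0)"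
      by eventually_elim auto
    moreover note eventually_not_in_period_lattice[OF assms]
    ultimately show ?thesis
    proof eventually_elim
      case (elim z)
      define w where "w = nome z"
      have w: "exp (a * z) = w" "exp (- a * z) = 1 / w" "w \<noteq> 0"
        by (simp_all add: w_def nome_def a_def exp_minus field_simps)
      have "w \<noteq> 1"
        using nome_powers_ne_1(1)[OF elim(2), of 0] by (simp add: w_def)
      have "z \<noteq> 0"
        using elim(2) zero_in_period_lattice by auto
      have "lambert_ext q w = w / (1 - w) + lambert_gen q (q * w)"
        using lambert_ext_functional_equation[OF q, of w] lambert_ext_eq_gen[OF q, of "q * w"]
          elim(1) w by simp
      moreover have "lambert_ext q (q / w) = lambert_gen q (q / w)"
        using lambert_ext_eq_gen[OF q, of "q / w"] elim(1) w by simp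
      moreover have "- (w / (1 - w)) = 1 + 1 / (w - 1)"
        using \<open>w \<noteq> 1\<close> by (simp add: field_simps)
      ultimately have "- (1 / 2) - lambert_ext q w + lambert_ext q (q / w) =
                 1 / 2 + 1 / (w - 1) + (lambert_gen q (q / w) - lambert_gen q (q * w))"
        by simp
      hence "theta_log_deriv \<tau> z = a * (1 / 2 + 1 / (w - 1) + (lambert_gen q (q / w) - lambert_gen q (q * w)))"
        by (simp only: theta_log_deriv_def a_def q_def w_def)
      also have "\<dots> = f z + 1 / z"
        unfolding f_def w using \<open>z \<noteq> 0\<close> by (simp add: distrib_left)
      finally show ?case by simp
    qed
  qed
  ultimately show ?thesis
    using that by blast
qed

section \<open>Eisenstein series are quasimodular\<close>

text \<open>
  The Liouville argument: the left-hand side is the regular part of \<open>Z(\<gamma>\<tau>, z/J)/J\<close>, the poles \<open>1/z\<close> cancel, and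
  the linear term repairs the quasi-periods.
\<close>
lemma theta_reg_fps_moebius:
  assumes \<tau>: "\<tau> \<in> upper_half_plane" and det: "a * d - b * c = (1::int)"
  defines "J \<equiv> of_int c * \<tau> + of_int d"
    and "\<gamma> \<equiv> (of_int a * \<tau> + of_int b) / (of_int c * \<tau> + of_int d)"
  obtains C where
    "fps_const (1 / J) * (theta_reg_fps \<gamma> oo (fps_const (1 / J) * fps_X)) =
       theta_reg_fps \<tau> + fps_const (2 * of_real pi * \<i> * of_int c / J) * fps_X + fps_const C"
proof -
  have J: "J \<noteq> 0"
    unfolding J_def by (rule automorphy_factor_nonzero) fact+
  have \<gamma>: "\<gamma> \<in> upper_half_plane"
    unfolding \<gamma>_def by (rule moebius_in_upper_half_plane) fact+
  have \<gamma>J: "\<gamma> * J = of_int a * \<tau> + of_int b"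
    using J unfolding \<gamma>_def J_def by simp
  have detC: "of_int a * of_int d - of_int b * of_int c = (1 :: complex)"
    using arg_cong[OF det, of "of_int :: int \<Rightarrow> complex"] by simp
  define K where "K = 2 * of_real pi * \<i> * of_int c / J"
  define H where "H = (\<lambda>z. theta_log_deriv \<gamma> (z / J) / J - theta_log_deriv \<tau> z - K * z)"
  \<comment> \<open>A period of \<open>\<tau>\<close>, divided by \<open>J\<close> and written in the basis of the lattice of \<open>\<gamma>\<close>; the coefficient of \<open>\<gamma>\<close> governs the jump of \<open>Z\<close>.\<close>
  have period: "(of_int m * \<tau> + of_int n) / J = of_int (m * d - n * c) * \<gamma> + of_int (n * a - m * b)" for m n
  proof -
    have "(of_int (m * d - n * c) * \<gamma> + of_int (n * a - m * b)) * J =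
            of_int (m * d - n * c) * (\<gamma> * J) + of_int (n * a - m * b) * J"
      by (simp only: distrib_right mult.assoc)
    also have "\<dots> = (of_int a * of_int d - of_int b * of_int c) * (of_int m * \<tau> + of_int n)"
      unfolding \<gamma>J unfolding J_def by (simp add: algebra_simps)
    finally show ?thesis
      using J by (simp only: detC) (simp add: divide_eq_eq)
  qed
  have lattice: "z \<in> period_lattice \<tau>" if z: "z / J \<in> period_lattice \<gamma>" for z
  proof -
    obtain m n where "z / J = of_int m * \<gamma> + of_int n"
      using z unfolding period_lattice_def by blast
    hence "z = of_int m * (\<gamma> * J) + of_int n * J"
      using J by (simp add: divide_eq_eq distrib_right mult.assoc)
    also have "\<dots> = of_int (m * a + n * c) * \<tau> + of_int (m * b + n * d)"
      unfolding \<gamma>J unfolding J_def by (simp add: algebra_simps)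
    finally show ?thesis
      unfolding period_lattice_def by blast
  qed

  obtain f where f: "f has_fps_expansion theta_reg_fps \<tau>"
      "eventually (\<lambda>z. f z = theta_log_deriv \<tau> z - 1 / z) (at 0)"
    using theta_log_deriv_has_fps_expansion[OF \<tau>] by blast
  obtain g where g: "g has_fps_expansion theta_reg_fps \<gamma>"
      "eventually (\<lambda>z. g z = theta_log_deriv \<gamma> z - 1 / z) (at 0)"
    using theta_log_deriv_has_fps_expansion[OF \<gamma>] by blast
  define h where "h = (\<lambda>z. 1 / J * (g \<circ> (\<lambda>z. 1 / J * z)) z - f z - K * z)"
  define \<Phi> where "\<Phi> = fps_const (1 / J) * (theta_reg_fps \<gamma> oo (fps_const (1 / J) * fps_X)) -
                          theta_reg_fps \<tau> - fps_const K * fps_X"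
  have h: "h has_fps_expansion \<Phi>"
    unfolding h_def \<Phi>_def
    by (intro has_fps_expansion_diff has_fps_expansion_cmult_left has_fps_expansion_compose
          has_fps_expansion_fps_X f(1) g(1)) auto
  have H_h: "eventually (\<lambda>z. H z = h z) (at 0)"
  proof -
    have "filterlim (\<lambda>z. 1 / J * z) (at 0) (at 0)"
    proof (rule filterlim_atI)
      show "(\<lambda>z. 1 / J * z) \<midarrow>0\<rightarrow> 0"
        by (rule tendsto_eq_intros refl | simp)+
      show "eventually (\<lambda>z. 1 / J * z \<noteq> 0) (at 0)"
        using J by (auto simp: eventually_at_filter)
    qed
    from g(2) this have "eventually (\<lambda>z. g (1 / J * z) = theta_log_deriv \<gamma> (1 / J * z) - 1 / (1 / J * z)) (at 0)"
      by (rule eventually_compose_filterlim)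
    with f(2) show ?thesis
    proof eventually_elim
      case (elim z)
      show ?case
        unfolding H_def h_def o_def elim using J by (simp add: field_simps)
    qed
  qed
  obtain U where U: "open U" "0 \<in> U" "h holomorphic_on U"
    using has_fps_expansion_imp_holomorphic[OF h] by blast
  obtain V where V: "open V" "0 \<in> V" "\<And>z. z \<in> V \<Longrightarrow> z \<noteq> 0 \<Longrightarrow> H z = h z"
    using H_h by (auto simp: eventually_at_topological)
  obtain C where C: "\<And>z. z \<notin> period_lattice \<tau> \<Longrightarrow> H z = C"
  proof (rule elliptic_holomorphic_constant[OF \<tau>])
    show "open (U \<inter> V)" "0 \<in> U \<inter> V" "h holomorphic_on U \<inter> V"
      using U V by (auto intro: holomorphic_on_subset)
    show "H z = h z" if "z \<in> U \<inter> V - {0}" for z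
      using V(3) that by auto
  next
    fix z assume z: "z \<notin> period_lattice \<tau>"
    have zJ: "z / J \<notin> period_lattice \<gamma>"
      using lattice z by blast
    have "(theta_log_deriv \<gamma> \<circ> (\<lambda>z. z / J)) field_differentiable (at z)"
      using J by (intro field_differentiable_compose theta_log_deriv_differentiable[OF \<gamma> zJ]
                    field_differentiable_divide field_differentiable_ident field_differentiable_const)
    hence "(\<lambda>z. theta_log_deriv \<gamma> (z / J)) field_differentiable (at z)"
      by (simp add: o_def)
    thus "H field_differentiable (at z)"
      unfolding H_def using J
      by (intro field_differentiable_diff field_differentiable_divide field_differentiable_mult
            field_differentiable_ident field_differentiable_const
            theta_log_deriv_differentiable[OF \<tau> z])
    fix \<omega> assume "\<omega> \<in> period_lattice \<tau>"
    then obtain m n where \<omega>: "\<omega> = of_int m * \<tau> + of_int n"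
      unfolding period_lattice_def by blast
    define T where "T = 2 * of_real pi * \<i>"
    have "theta_log_deriv \<gamma> ((z + \<omega>) / J) = theta_log_deriv \<gamma> (z / J) - T * of_int (m * d - n * c)"
      unfolding \<omega> add_divide_distrib[of z] period T_def by (rule theta_log_deriv_add_period[OF \<gamma> zJ])
    moreover have "theta_log_deriv \<tau> (z + \<omega>) = theta_log_deriv \<tau> z - T * of_int m"
      unfolding \<omega> T_def by (rule theta_log_deriv_add_period[OF \<tau> z])
    moreover have "K * \<omega> = T * of_int m - T * of_int (m * d - n * c) / J"
      using J unfolding K_def \<omega> T_def[symmetric]
      by (simp add: field_simps) (simp add: J_def algebra_simps)
    ultimately show "H (z + \<omega>) = H z"
      unfolding H_def by (simp add: diff_divide_distrib distrib_left)
  qed (rule that)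
  have "h has_fps_expansion \<Phi>" "(\<lambda>_. C) has_fps_expansion fps_const C"
    using h by auto
  moreover have "eventually (\<lambda>z. h z = C) (at 0)"
    using H_h eventually_not_in_period_lattice[OF \<tau>] by eventually_elim (use C in metis)
  ultimately have "\<Phi> = fps_const C"
    by (rule fps_expansion_eq_at)
  hence "fps_const (1 / J) * (theta_reg_fps \<gamma> oo (fps_const (1 / J) * fps_X)) =
           theta_reg_fps \<tau> + fps_const K * fps_X + fps_const C"
    unfolding \<Phi>_def by (simp add: diff_eq_eq add_ac)
  thus ?thesis
    unfolding K_def by (rule that)
qed

text \<open>
  Compare coefficients of degree \<open>k - 1\<close>.  The linear term is only seen for \<open>k = 2\<close>, where the factor in front
  of \<open>G\<^sub>2\<close> is \<open>- 2 (2\<pi>\<i>)\<^sup>2 = 8\<pi>\<^sup>2\<close> and \<open>2\<pi>\<i> / (8\<pi>\<^sup>2) = \<i> / (4\<pi>)\<close>.  The constant of integration has degree \<open>0\<close> and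
  does not interfere, because \<open>k - 1 \<ge> 1\<close>.
\<close>
lemma eisenstein_G_moebius:
  assumes \<tau>: "\<tau> \<in> upper_half_plane" and det: "a * d - b * c = (1::int)"
    and k: "even k" "k \<ge> 2"
  defines "J \<equiv> of_int c * \<tau> + of_int d"
  shows "eisenstein_G k ((of_int a * \<tau> + of_int b) / J) =
           J ^ k * (eisenstein_G k \<tau> + (if k = 2 then \<i> / (4 * of_real pi) else 0) * (of_int c / J))"
proof -
  have J: "J \<noteq> 0"
    unfolding J_def by (rule automorphy_factor_nonzero) fact+
  define A :: complex where "A = - 2 * (2 * of_real pi * \<i>) ^ k / fact (k - 1)"
  have A: "A \<noteq> 0"
    by (simp add: A_def)
  obtain C where C: "fps_const (1 / J) * (theta_reg_fps ((of_int a * \<tau> + of_int b) / J) oo (fps_const (1 / J) * fps_X)) =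
       theta_reg_fps \<tau> + fps_const (2 * of_real pi * \<i> * of_int c / J) * fps_X + fps_const C"
    using theta_reg_fps_moebius[OF \<tau> det] unfolding J_def by blast
  have nth: "fps_nth (theta_reg_fps t) (k - 1) = A * eisenstein_G k t" for t
    unfolding A_def by (rule theta_reg_fps_nth) fact+
  have "1 / J * ((1 / J) ^ (k - 1) * fps_nth (theta_reg_fps ((of_int a * \<tau> + of_int b) / J)) (k - 1)) =
          fps_nth (theta_reg_fps \<tau>) (k - 1) + (if k = 2 then 2 * of_real pi * \<i> * of_int c / J else 0)"
  proof (cases "k = 2")
    case True
    thus ?thesis
      using arg_cong[OF C, of "\<lambda>F. fps_nth F 1"] by (simp add: fps_compose_linear)
  next
    case False
    then obtain m where "k = Suc (Suc (Suc m))"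
      using k(2) by (metis add_2_eq_Suc le_Suc_ex not0_implies_Suc add_0_right)
    thus ?thesis
      using arg_cong[OF C, of "\<lambda>F. fps_nth F (k - 1)"] by (simp add: fps_compose_linear)
  qed
  hence "1 / J * ((1 / J) ^ (k - 1) * (A * eisenstein_G k ((of_int a * \<tau> + of_int b) / J))) =
          A * eisenstein_G k \<tau> + (if k = 2 then 2 * of_real pi * \<i> * of_int c / J else 0)"
    unfolding nth .
  moreover have "(if k = 2 then 2 * of_real pi * \<i> * of_int c / J else 0) =
                 A * ((if k = 2 then \<i> / (4 * of_real pi) else 0) * (of_int c / J))"
    by (simp add: A_def power2_eq_square)
  moreover have "1 / J * (1 / J) ^ (k - 1) = 1 / J ^ k"
    using k by (cases k) (simp_all add: power_divide)
  ultimately have "A * eisenstein_G k ((of_int a * \<tau> + of_int b) / J) / J ^ k =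
          A * (eisenstein_G k \<tau> + (if k = 2 then \<i> / (4 * of_real pi) else 0) * (of_int c / J))"
    by (simp only: distrib_left mult.assoc[symmetric]) simp
  thus ?thesis
    using A J by (simp add: divide_eq_eq mult_ac)
qed

lemma quasimodular_eisenstein_G:
  assumes "even k" "k \<ge> 2"
  shows "quasimodular_form_of_weight k (eisenstein_G k)"
proof (rule quasimodular_form_of_weightI)
  define g where "g = (\<lambda>j::nat. if j = 0 then eisenstein_G k else
     (\<lambda>_. if j = 1 \<and> k = 2 then \<i> / (4 * of_real pi) else 0))"
  show "eisenstein_G k holomorphic_on upper_half_plane"
    by (rule has_q_expansion_holomorphic[OF eisenstein_G_has_q_expansion])
  thus "g j holomorphic_on upper_half_plane" for j
    by (auto simp: g_def)
  show "bounded_at_ii_inf (g j)" for j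
    using has_q_expansion_bounded[OF eisenstein_G_has_q_expansion[of k]]
    by (auto simp: g_def bounded_at_ii_inf_def)
  show "eisenstein_G k ((of_int a * \<tau> + of_int b) / (of_int c * \<tau> + of_int d)) =
         (of_int c * \<tau> + of_int d) ^ k *
         (\<Sum>j\<le>1. g j \<tau> * (of_int c / (of_int c * \<tau> + of_int d)) ^ j)"
    if "a * d - b * c = 1" "\<tau> \<in> upper_half_plane" for a b c d :: int and \<tau>
    unfolding eisenstein_G_moebius[OF that(2,1) assms] by (simp add: g_def)
qed

lemma quasimodular_eisenstein_imp_quasimodular_form:
  assumes "f \<in> quasimodular_eisenstein"
  shows "quasimodular_form f"
proof -
  obtain S :: "(nat \<times> nat) set" and a where S: "finite S" "\<And>l k. (l, k) \<in> S \<Longrightarrow> even k \<and> 2 \<le> k"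
    and f: "\<And>\<tau>. \<tau> \<in> upper_half_plane \<Longrightarrow> f \<tau> = (\<Sum>(l, k)\<in>S. a (l, k) * (qD ^^ l) (eisenstein_G k) \<tau>)"
    using assms unfolding quasimodular_eisenstein_def by blast
  define wt :: "nat \<times> nat \<Rightarrow> nat" where "wt = (\<lambda>(l, k). k + 2 * l)"
  define G where "G = (\<lambda>(l, k). (qD ^^ l) (eisenstein_G k))"
  define F where "F = (\<lambda>w \<tau>. \<Sum>i\<in>{i \<in> S. wt i = w}. a i * G i \<tau>)"
  have "quasimodular_form_of_weight w (F w)" for w
    unfolding F_def
  proof (rule quasimodular_form_of_weight_sum)
    fix i assume i: "i \<in> {i \<in> S. wt i = w}"
    obtain l k where "i = (l, k)" by (cases i)
    with i S(2)[of l k] show "quasimodular_form_of_weight w (G i)"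
      using quasimodular_form_of_weight_qD_iterate[OF quasimodular_eisenstein_G, of k l]
      by (auto simp: G_def wt_def)
  qed
  \<comment> \<open>The sum of all weights is a convenient upper bound for each of them.\<close>
  moreover have "f \<tau> = (\<Sum>w\<le>sum wt S. F w \<tau>)" if \<tau>: "\<tau> \<in> upper_half_plane" for \<tau>
  proof -
    have "wt ` S \<subseteq> {..sum wt S}"
      using S(1) by (auto intro: member_le_sum)
    hence "(\<Sum>w\<le>sum wt S. F w \<tau>) = (\<Sum>i\<in>S. a i * G i \<tau>)"
      unfolding F_def using S(1) by (intro sum.group) auto
    thus ?thesis
      by (simp add: f[OF \<tau>] G_def case_prod_unfold)
  qed
  ultimately show ?thesis
    unfolding quasimodular_form_def by blast
qed

section \<open>Polynomials with zeros at primes\<close>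

text \<open>
  Divided by \<open>p\<close> to the power \<open>degree P\<close>, the left-hand side tends to \<open>\<bar>lead_coeff P\<bar> > 0\<close>, whereas the bound would
  be at most \<open>C / sqrt p\<close> if \<open>degree P \<ge> r\<close>.
\<close>
lemma poly_degree_less_of_prime_bound:
  fixes P :: "complex poly"
  assumes bound: "\<And>p::nat. prime p \<Longrightarrow> norm (poly P (of_nat p)) \<le> C * real p powr (real r - 1 / 2)"
    and "P \<noteq> 0"
  shows "degree P < r"
proof (rule ccontr)
  assume "\<not> degree P < r"
  hence deg: "degree P \<ge> r" by simp
  have "((\<lambda>x. poly P x / x ^ degree P) \<longlongrightarrow> lead_coeff P) at_infinity"
    by (rule poly_divide_tendsto_aux)
  moreover have "filterlim (\<lambda>n. of_nat n :: complex) at_infinity sequentially"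
    by (rule tendsto_of_nat)
  ultimately have "(\<lambda>n. poly P (of_nat n) / of_nat n ^ degree P) \<longlonglongrightarrow> lead_coeff P"
    by (rule filterlim_compose)
  hence "(\<lambda>n. norm (poly P (of_nat n) / of_nat n ^ degree P)) \<longlonglongrightarrow> norm (lead_coeff P)"
    by (rule tendsto_norm)
  moreover have "(\<lambda>n. C * real n powr (- (1 / 2))) \<longlonglongrightarrow> C * 0"
    by (rule tendsto_mult[OF tendsto_const tendsto_neg_powr[OF _ filterlim_real_sequentially]]) simp
  ultimately have "(\<lambda>n. norm (poly P (of_nat n) / of_nat n ^ degree P) - C * real n powr (- (1 / 2)))
                      \<longlonglongrightarrow> norm (lead_coeff P) - C * 0"
    by (rule tendsto_diff)
  moreover have "norm (lead_coeff P) - C * 0 > 0"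
    using \<open>P \<noteq> 0\<close> by simp
  ultimately have "eventually (\<lambda>n. 0 < norm (poly P (of_nat n) / of_nat n ^ degree P) -
                      C * real n powr (- (1 / 2))) sequentially"
    by (rule order_tendstoD(1))
  hence "eventually (\<lambda>n. C * real n powr (- (1 / 2)) <
                      norm (poly P (of_nat n) / of_nat n ^ degree P)) sequentially"
    by eventually_elim linarith
  then obtain N where N: "\<And>n. n \<ge> N \<Longrightarrow> C * real n powr (- (1 / 2)) <
                      norm (poly P (of_nat n) / of_nat n ^ degree P)"
    by (auto simp: eventually_at_top_linorder)
  obtain p :: nat where p: "prime p" "p > N"
    using bigger_prime by blast
  have p1: "real p \<ge> 1"
    using prime_ge_1_nat[OF p(1)] by simp
  have "C * real p powr (- (1 / 2)) < norm (poly P (of_nat p)) / real p ^ degree P"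
    using N[of p] p(2) by (simp add: norm_divide norm_power)
  hence "C * real p powr (- (1 / 2)) * real p ^ degree P < norm (poly P (of_nat p))"
    using p1 by (simp add: pos_less_divide_eq)
  also have "\<dots> \<le> C * real p powr (real r - 1 / 2)"
    using bound[OF p(1)] .
  also have "real p powr (real r - 1 / 2) = real p powr (- (1 / 2)) * real p ^ r"
    using p1 by (simp add: powr_realpow[symmetric] powr_add[symmetric])
  finally have lt: "(C * real p powr (- (1 / 2))) * real p ^ degree P < (C * real p powr (- (1 / 2))) * real p ^ r"
    by (simp add: mult_ac)
  have "C * real p powr (real r - 1 / 2) \<ge> 0"
    using order_trans[OF norm_ge_zero bound[OF p(1)]] .
  hence "C \<ge> 0"
    using p1 by (simp add: zero_le_mult_iff)
  hence "(C * real p powr (- (1 / 2))) * real p ^ r \<le> (C * real p powr (- (1 / 2))) * real p ^ degree P"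
    using deg p1 by (intro mult_left_mono power_increasing) auto
  with lt show False by simp
qed

lemma poly_eq_0_of_prime_zeros:
  fixes P :: "complex poly" and p :: "nat \<Rightarrow> nat"
  assumes "\<And>p::nat. prime p \<Longrightarrow> norm (poly P (of_nat p)) \<le> C * real p powr (real r - 1 / 2)"
    and "inj_on p {1..r}" "\<And>j. j \<in> {1..r} \<Longrightarrow> poly P (of_nat (p j)) = 0"
  shows "P = 0"
proof (rule ccontr)
  assume "P \<noteq> 0"
  have "degree P < r"
    by (rule poly_degree_less_of_prime_bound[OF assms(1) \<open>P \<noteq> 0\<close>])
  have "inj_on (\<lambda>j. of_nat (p j) :: complex) {1..r}"
    using inj_onD[OF assms(2)] by (intro inj_onI) simp
  hence "r = card ((\<lambda>j. of_nat (p j) :: complex) ` {1..r})"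
    using card_image by fastforce
  also have "\<dots> \<le> card {x. poly P x = 0}"
  proof (rule card_mono)
    show "finite {x. poly P x = 0}"
      using \<open>P \<noteq> 0\<close> by (rule poly_roots_finite)
  qed (use assms(3) in blast)
  also have "\<dots> \<le> degree P"
    using \<open>P \<noteq> 0\<close> by (rule card_poly_roots_bound)
  finally show False
    using \<open>degree P < r\<close> by simp
qed

section \<open>Coefficients at primes\<close>

lemma eisenstein_coeff_prime:
  assumes "prime p"
  shows "eisenstein_coeff k p = 1 + of_nat p ^ (k - 1)"
proof -
  have "{d. d dvd p} = {1, p}"
    using assms by (auto simp: prime_nat_iff)
  moreover have "p \<noteq> 1" "p \<noteq> 0"
    using assms by (auto simp: prime_nat_iff)
  ultimately show ?thesis
    by (simp add: eisenstein_coeff_def divisor_sigma_def)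
qed

text \<open>
  A prime has only the divisors \<open>1\<close> and \<open>p\<close>, so \<open>\<sigma>\<^sub>k\<^sub>-\<^sub>1(p) = 1 + p\<^sup>k\<^sup>-\<^sup>1\<close> is a polynomial in \<open>p\<close>; applying \<open>D\<close> only
  multiplies by \<open>p\<close>.
\<close>
lemma quasimodular_eisenstein_prime_coeff:
  assumes "f \<in> quasimodular_eisenstein"
  obtains P :: "complex poly" where "\<And>p. prime p \<Longrightarrow> q_coeff f p = poly P (of_nat p)"
proof -
  obtain S :: "(nat \<times> nat) set" and a where
    f: "\<And>\<tau>. \<tau> \<in> upper_half_plane \<Longrightarrow> f \<tau> = (\<Sum>(l, k)\<in>S. a (l, k) * (qD ^^ l) (eisenstein_G k) \<tau>)"
    using assms unfolding quasimodular_eisenstein_def by blast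
  have "has_q_expansion f (\<lambda>n. \<Sum>i\<in>S. a i * (of_nat n ^ fst i * eisenstein_coeff (snd i) n))"
    by (rule has_q_expansion_sum[where f = "\<lambda>i. (qD ^^ fst i) (eisenstein_G (snd i))"])
       (auto simp: f case_prod_unfold intro!: has_q_expansion_qD_iterate eisenstein_G_has_q_expansion)
  hence coeff: "q_coeff f = (\<lambda>n. \<Sum>i\<in>S. a i * (of_nat n ^ fst i * eisenstein_coeff (snd i) n))"
    by (rule q_coeff_eq)
  show ?thesis
  proof (rule that)
    fix p :: nat assume "prime p"
    thus "q_coeff f p =
        poly (\<Sum>i\<in>S. smult (a i) (monom 1 (fst i) * (1 + monom 1 (snd i - 1)))) (of_nat p)"
      by (simp add: coeff eisenstein_coeff_prime poly_sum poly_monom)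
  qed
qed

theorem theorem1p3:
  fixes f :: "complex \<Rightarrow> complex" and r :: nat
  assumes "f \<in> quasimodular_eisenstein"
    and "r \<ge> 1"
    and "\<forall>\<epsilon>::real. \<epsilon> > 0 \<longrightarrow>
           (\<exists>C::real. C > 0 \<and> (\<forall>n::nat. n \<ge> 1 \<longrightarrow>
              cmod (q_coeff f n) \<le> C * real n powr (real r - 1 + \<epsilon>)))"
  shows "f \<in> Omega_tilde \<longleftrightarrow>
           (\<exists>p :: nat \<Rightarrow> nat. inj_on p {1..r} \<and>
              (\<forall>j\<in>{1..r}. prime (p j) \<and> q_coeff f (p j) = 0))"
proof
  assume "f \<in> Omega_tilde"
  hence zero: "\<And>p. prime p \<Longrightarrow> q_coeff f p = 0"
    by (simp add: Omega_tilde_def)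
  have "infinite {p::nat. prime p}"
    by (rule primes_infinite)
  then obtain p :: "nat \<Rightarrow> nat" where "inj p" "range p \<subseteq> {p. prime p}"
    using infinite_countable_subset by blast
  hence "inj_on p {1..r} \<and> (\<forall>j\<in>{1..r}. prime (p j) \<and> q_coeff f (p j) = 0)"
    using zero by (auto intro: inj_on_subset)
  thus "\<exists>p :: nat \<Rightarrow> nat. inj_on p {1..r} \<and> (\<forall>j\<in>{1..r}. prime (p j) \<and> q_coeff f (p j) = 0)"
    by blast
next
  assume "\<exists>p :: nat \<Rightarrow> nat. inj_on p {1..r} \<and> (\<forall>j\<in>{1..r}. prime (p j) \<and> q_coeff f (p j) = 0)"
  then obtain p :: "nat \<Rightarrow> nat" where p: "inj_on p {1..r}"
    "\<And>j. j \<in> {1..r} \<Longrightarrow> prime (p j) \<and> q_coeff f (p j) = 0"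
    by blast
  obtain P where P: "\<And>p. prime p \<Longrightarrow> q_coeff f p = poly P (of_nat p)"
    using quasimodular_eisenstein_prime_coeff[OF assms(1)] by blast
  \<comment> \<open>Any exponent strictly below \<open>r\<close> will do.\<close>
  have "\<exists>C>0. \<forall>n\<ge>1. cmod (q_coeff f n) \<le> C * real n powr (real r - 1 + 1 / 2)"
    using assms(3) by (elim allE[of _ "1 / 2"]) simp
  then obtain C where C: "\<And>n. n \<ge> 1 \<Longrightarrow> cmod (q_coeff f n) \<le> C * real n powr (real r - 1 + 1 / 2)"
    by blast
  have "P = 0"
  proof (rule poly_eq_0_of_prime_zeros[OF _ p(1)])
    show "cmod (poly P (of_nat p)) \<le> C * real p powr (real r - 1 / 2)" if "prime p" for p
      using C[of p] P[OF that] prime_ge_1_nat[OF that] by simp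
    show "poly P (of_nat (p j)) = 0" if "j \<in> {1..r}" for j
      using p(2)[OF that] P by metis
  qed
  hence "q_coeff f p = 0" if "prime p" for p
    using P[OF that] by simp
  thus "f \<in> Omega_tilde"
    unfolding Omega_tilde_def
    using quasimodular_eisenstein_imp_quasimodular_form[OF assms(1)] by blast
qed

end
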